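(* Let $\nu=0$ and $\mathbf{f}=\mathbf{0}$, and let $(\mathbf{u}_h^{n+1},P_h^{n+1})_{0\le n\le N-1}$ be a solution of the EMAC-FILTERED scheme, i.e. for $n=0,1,\dots,N-1$ and all $(\mathbf{v}_h,q_h)\in\mathbf{X}_h\times Q_h$, $$\frac{1}{\Delta t}\Big(\tfrac32\mathbf{u}_h^{n+1}-2\mathbf{u}_h^n+\tfrac12\mathbf{u}_h^{n-1},\mathbf{v}_h\Big)+\nu\big(\nabla F[\mathbf{u}_h^{n+1}],\nabla\mathbf{v}_h\big)+c\big(F[\mathbf{u}_h^{n+1}],F[\mathbf{u}_h^{n+1}],\mathbf{v}_h\big)-(P_h^{n+1},\nabla\cdot\mathbf{v}_h)=(\mathbf{f}(t^{n+1}),\mathbf{v}_h),$$ $$(\nabla\cdot F[\mathbf{u}_h^{n+1}],q_h)=0 .$$ Assume that the discrete velocities and pressures vanish on a strip $\Omega_s$ around $\partial\Omega$ (as specified in the context). Then the scheme conserves momentum and angular momentum for all (discrete) times $t=t^n>0$: $$M(t)=M(0),\qquad AM(t)=AM(0),$$ where $M(t^n)=\int_\Omega\mathbf{u}_h^n\,d\mathbf{x}$ and $AM(t^n)=\int_\Omega\mathbf{u}_h^n\times\mathbf{x}\,d\mathbf{x}$.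
   Context: Domain and spaces: $\Omega\subset\mathbb{R}^d$, $d\in\{2,3\}$, is a convex polygonal or polyhedral domain; $(\cdot,\cdot)$ and $\|\cdot\|$ are the $L^2(\Omega)$ inner product and norm; $\mathbf{X}=(H_0^1(\Omega))^d$, $Q=L_0^2(\Omega)$. $\mathbf{X}_h\subset\mathbf{X}$, $Q_h\subset Q$ are finite element spaces on a regular conforming triangulation of $\Omega$ with maximal diameter $h$, satisfying the discrete inf-sup condition $\inf_{q_h\in Q_h}\sup_{\mathbf{v}_h\in\mathbf{X}_h}\frac{(q_h,\nabla\cdot\mathbf{v}_h)}{\|\nabla\mathbf{v}_h\|\,\|q_h\|}\ge\beta_0>0$. Data: $T$ is the final time, $N$ the number of time steps, $\Delta t=T/N$, $t^n=n\Delta t$. $\mathbf{u}_h^0$ and $\mathbf{u}_h^{-1}$ are both the nodal interpolant in $\mathbf{X}_h$ of the initial velocity $\mathbf{u}_0$. Trilinear form (EMAC): $c(\mathbf{u},\mathbf{v},\mathbf{w})=2(\mathbb{D}(\mathbf{u})\mathbf{v},\mathbf{w})+((\nabla\cdot\mathbf{u})\mathbf{v},\mathbf{w})$ with $\mathbb{D}(\mathbf{u})=\frac12(\nabla\mathbf{u}+(\nabla\mathbf{u})^T)$. Time-filter operator: $F[\mathbf{w}^{n+1}]=\frac32\mathbf{w}^{n+1}-\mathbf{w}^n+\frac12\mathbf{w}^{n-1}$. Momentum and angular momentum componentwise: with $e_i$ the $i$-th unit vector and $\phi_i=\mathbf{x}\times e_i$, $M_i=(\mathbf{u},e_i)$ and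 $(AM)_i=\int_\Omega(\mathbf{u}\times\mathbf{x})\cdot e_i\,d\mathbf{x}=(\mathbf{u},\phi_i)$ (for $d=2$, vectors are embedded in $\mathbb{R}^3$ in the usual way for the cross product). Strip assumption (solutions compactly supported, e.g. an isolated vortex): $\Omega=\Omega_s\cup\Omega_i$ with $\Omega_s$ a strip around $\partial\Omega$, and the discrete solutions satisfy $\mathbf{u}_h^n=\mathbf{0}$ and $P_h^n=0$ on $\Omega_s$ for all $n$. For $g=e_i$ and $g=\phi_i$, $\chi(g)$ denotes a function equal to $g$ on $\Omega_i$ and arbitrarily defined on $\Omega_s$ so that it vanishes on $\partial\Omega$; such functions $\chi(e_i),\chi(\phi_i)$ are taken to be available as test functions in $\mathbf{X}_h$. *)

theory Defs
  imports "HOL-Analysis.Analysis"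
begin

section \<open>Lebesgue and Sobolev spaces\<close>

text \<open>Elements of the function spaces are represented by everywhere defined functions; only
  their restriction to \<open>\<Omega>\<close> matters, and all notions below are insensitive to null sets unless
  said otherwise.\<close>

definition L2 :: "(real^'d::finite) set \<Rightarrow> (real^'d \<Rightarrow> 'b::euclidean_space) set" where
  "L2 \<Omega> = {f \<in> borel_measurable (lebesgue_on \<Omega>).
             integrable (lebesgue_on \<Omega>) (\<lambda>x. (norm (f x))\<^sup>2)}"

definition L2_inner ::
  "(real^'d::finite) set \<Rightarrow> (real^'d \<Rightarrow> 'b::euclidean_space) \<Rightarrow> (real^'d \<Rightarrow> 'b) \<Rightarrow> real" where
  "L2_inner \<Omega> f g = (LINT x|lebesgue_on \<Omega>. f x \<bullet> g x)"

definition L2_norm :: "(real^'d::finite) set \<Rightarrow> (real^'d \<Rightarrow> 'b::euclidean_space) \<Rightarrow> real" where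
  "L2_norm \<Omega> f = sqrt (L2_inner \<Omega> f f)"

definition L2_zero_mean :: "(real^'d::finite) set \<Rightarrow> (real^'d \<Rightarrow> real) set" where
  "L2_zero_mean \<Omega> = {q \<in> L2 \<Omega>. (LINT x|lebesgue_on \<Omega>. q x) = 0}"

primrec C_k :: "nat \<Rightarrow> (real^'d::finite \<Rightarrow> real) \<Rightarrow> bool" where
  "C_k 0 f \<longleftrightarrow> continuous_on UNIV f"
| "C_k (Suc k) f \<longleftrightarrow> (\<forall>x. f differentiable at x) \<and>
     (\<forall>v. C_k k (\<lambda>x. frechet_derivative f (at x) v))"

definition partial :: "'d \<Rightarrow> (real^'d::finite \<Rightarrow> real) \<Rightarrow> real^'d \<Rightarrow> real" where
  "partial i f x = frechet_derivative f (at x) (axis i 1)"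

definition test_functions :: "(real^'d::finite) set \<Rightarrow> (real^'d \<Rightarrow> real) set" where
  "test_functions \<Omega> = {\<phi>. (\<forall>k. C_k k \<phi>) \<and>
     compact (closure {x. \<phi> x \<noteq> 0}) \<and> closure {x. \<phi> x \<noteq> 0} \<subseteq> \<Omega>}"

definition has_weak_partial ::
  "(real^'d::finite) set \<Rightarrow> 'd \<Rightarrow> (real^'d \<Rightarrow> real) \<Rightarrow> (real^'d \<Rightarrow> real) \<Rightarrow> bool" where
  "has_weak_partial \<Omega> i u g \<longleftrightarrow>
     (\<forall>\<phi>\<in>test_functions \<Omega>. L2_inner \<Omega> u (partial i \<phi>) = - L2_inner \<Omega> g \<phi>)"

definition H1 :: "(real^'d::finite) set \<Rightarrow> (real^'d \<Rightarrow> real) set" where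
  "H1 \<Omega> = {u \<in> L2 \<Omega>. \<forall>i. \<exists>g\<in>L2 \<Omega>. has_weak_partial \<Omega> i u g}"

text \<open>The weak derivative is unique up to null sets; a representative is chosen.\<close>

definition weak_partial ::
  "(real^'d::finite) set \<Rightarrow> 'd \<Rightarrow> (real^'d \<Rightarrow> real) \<Rightarrow> real^'d \<Rightarrow> real" where
  "weak_partial \<Omega> i u = (SOME g. g \<in> L2 \<Omega> \<and> has_weak_partial \<Omega> i u g)"

text \<open>\<open>H\<^sub>0\<^sup>1\<close> is the closure of the test functions with respect to the \<open>H\<^sup>1\<close> norm.\<close>

definition H10 :: "(real^'d::finite) set \<Rightarrow> (real^'d \<Rightarrow> real) set" where
  "H10 \<Omega> = {u \<in> H1 \<Omega>. \<exists>\<phi>::nat \<Rightarrow> real^'d \<Rightarrow> real. (\<forall>n. \<phi> n \<in> test_functions \<Omega>) \<and>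
     (\<lambda>n. L2_norm \<Omega> (\<lambda>x. u x - \<phi> n x)) \<longlonglongrightarrow> 0 \<and>
     (\<forall>i. (\<lambda>n. L2_norm \<Omega> (\<lambda>x. weak_partial \<Omega> i u x - partial i (\<phi> n) x)) \<longlonglongrightarrow> 0)}"

definition H10_vec :: "(real^'d::finite) set \<Rightarrow> (real^'d \<Rightarrow> real^'d) set" where
  "H10_vec \<Omega> = {u. \<forall>i. (\<lambda>x. u x $ i) \<in> H10 \<Omega>}"

definition wgrad ::
  "(real^'d::finite) set \<Rightarrow> (real^'d \<Rightarrow> real^'d) \<Rightarrow> real^'d \<Rightarrow> real^'d^'d" where
  "wgrad \<Omega> u x = (\<chi> i j. weak_partial \<Omega> j (\<lambda>y. u y $ i) x)"

definition wdiv :: "(real^'d::finite) set \<Rightarrow> (real^'d \<Rightarrow> real^'d) \<Rightarrow> real^'d \<Rightarrow> real" where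
  "wdiv \<Omega> u x = trace (wgrad \<Omega> u x)"

definition sym_grad ::
  "(real^'d::finite) set \<Rightarrow> (real^'d \<Rightarrow> real^'d) \<Rightarrow> real^'d \<Rightarrow> real^'d^'d" where
  "sym_grad \<Omega> u x = (1/2) *\<^sub>R (wgrad \<Omega> u x + transpose (wgrad \<Omega> u x))"


section \<open>Domain, triangulation and finite element spaces\<close>

definition convex_polytopal_domain :: "(real^'d::finite) set \<Rightarrow> bool" where
  "convex_polytopal_domain \<Omega> \<longleftrightarrow> open \<Omega> \<and> convex \<Omega> \<and> \<Omega> \<noteq> {} \<and> polytope (closure \<Omega>)"

text \<open>Conformity (two elements meet in a common face) is part of the library's
  \<^const>\<open>triangulation\<close>. The constant \<open>\<sigma>\<close> bounds the ratio of the diameter of an element to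
  the radius of an inscribed ball.\<close>

definition regular_mesh ::
  "(real^'d::finite) set \<Rightarrow> (real^'d) set set \<Rightarrow> real \<Rightarrow> real \<Rightarrow> bool" where
  "regular_mesh \<Omega> \<T> \<sigma> h \<longleftrightarrow> triangulation \<T> \<and> (\<forall>K\<in>\<T>. int CARD('d) simplex K) \<and>
     \<Union>\<T> = closure \<Omega> \<and> h = Max (diameter ` \<T>) \<and>
     (\<forall>K\<in>\<T>. \<exists>c r. r > 0 \<and> cball c r \<subseteq> K \<and> diameter K \<le> \<sigma> * r)"

text \<open>A finite-dimensional linear space of piecewise polynomial functions. The degree is bounded
  because the dimension is finite.\<close>

definition fe_space ::
  "(real^'d::finite) set set \<Rightarrow> (real^'d \<Rightarrow> 'b::euclidean_space) set \<Rightarrow> bool" where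
  "fe_space \<T> V \<longleftrightarrow>
     (\<exists>B. finite B \<and> V = range (\<lambda>(c::(real^'d \<Rightarrow> 'b) \<Rightarrow> real) x. \<Sum>b\<in>B. c b *\<^sub>R b x)) \<and>
     (\<forall>v\<in>V. \<forall>K\<in>\<T>. \<exists>p. polynomial_function p \<and> (\<forall>x\<in>interior K. v x = p x))"

text \<open>A piecewise polynomial function in \<open>H\<^sup>1\<close> has a continuous representative; it is the one
  used, so that point values (needed for nodal interpolation) are meaningful.\<close>

definition velocity_space ::
  "(real^'d::finite) set \<Rightarrow> (real^'d) set set \<Rightarrow> (real^'d \<Rightarrow> real^'d) set \<Rightarrow> bool" where
  "velocity_space \<Omega> \<T> Xh \<longleftrightarrow>
     fe_space \<T> Xh \<and> Xh \<subseteq> H10_vec \<Omega> \<and> (\<forall>v\<in>Xh. continuous_on (closure \<Omega>) v)"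

definition pressure_space ::
  "(real^'d::finite) set \<Rightarrow> (real^'d) set set \<Rightarrow> (real^'d \<Rightarrow> real) set \<Rightarrow> bool" where
  "pressure_space \<Omega> \<T> Qh \<longleftrightarrow> fe_space \<T> Qh \<and> Qh \<subseteq> L2_zero_mean \<Omega>"

text \<open>Extended reals make the infimum and supremum meaningful for all sets of quotients.\<close>

definition inf_sup_condition :: "(real^'d::finite) set \<Rightarrow>
    (real^'d \<Rightarrow> real^'d) set \<Rightarrow> (real^'d \<Rightarrow> real) set \<Rightarrow> real \<Rightarrow> bool" where
  "inf_sup_condition \<Omega> Xh Qh \<beta> \<longleftrightarrow> \<beta> > 0 \<and>
     (INF q\<in>{q\<in>Qh. L2_norm \<Omega> q \<noteq> 0}. SUP v\<in>{v\<in>Xh. L2_norm \<Omega> (wgrad \<Omega> v) \<noteq> 0}.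
        ereal (L2_inner \<Omega> q (wdiv \<Omega> v) / (L2_norm \<Omega> (wgrad \<Omega> v) * L2_norm \<Omega> q))) \<ge> ereal \<beta>"

text \<open>Nodal degrees of freedom: a pair \<open>(p, a)\<close> stands for the functional \<open>v \<mapsto> v(p) \<bullet> a\<close>.
  Lagrange elements have the pairs of a node and a standard basis vector. Nodes on the boundary
  are omitted since the functions in \<open>X\<^sub>h\<close> vanish there.\<close>

definition nodal_dofs :: "(real^'d::finite) set \<Rightarrow>
    (real^'d \<Rightarrow> real^'d) set \<Rightarrow> ((real^'d) \<times> (real^'d)) set \<Rightarrow> bool" where
  "nodal_dofs \<Omega> Xh \<N> \<longleftrightarrow> finite \<N> \<and> fst ` \<N> \<subseteq> \<Omega> \<and>
     (\<forall>c :: (real^'d) \<times> (real^'d) \<Rightarrow> real. \<exists>v\<in>Xh. \<forall>(p, a)\<in>\<N>. v p \<bullet> a = c (p, a)) \<and>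
     (\<forall>v\<in>Xh. (\<forall>(p, a)\<in>\<N>. v p \<bullet> a = 0) \<longrightarrow> (\<forall>x\<in>closure \<Omega>. v x = 0))"

definition nodal_interpolant :: "(real^'d::finite \<Rightarrow> real^'d) set \<Rightarrow>
    ((real^'d) \<times> (real^'d)) set \<Rightarrow> (real^'d \<Rightarrow> real^'d) \<Rightarrow> real^'d \<Rightarrow> real^'d" where
  "nodal_interpolant Xh \<N> w = (SOME v. v \<in> Xh \<and> (\<forall>(p, a)\<in>\<N>. v p \<bullet> a = w p \<bullet> a))"


section \<open>The EMAC-FILTERED scheme\<close>

definition emac :: "(real^'d::finite) set \<Rightarrow>
    (real^'d \<Rightarrow> real^'d) \<Rightarrow> (real^'d \<Rightarrow> real^'d) \<Rightarrow> (real^'d \<Rightarrow> real^'d) \<Rightarrow> real" where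
  "emac \<Omega> u v w = 2 * L2_inner \<Omega> (\<lambda>x. sym_grad \<Omega> u x *v v x) w
                + L2_inner \<Omega> (\<lambda>x. wdiv \<Omega> u x *\<^sub>R v x) w"

text \<open>\<open>time_filter w m\<close> is \<open>F[w\<^sup>m]\<close>. Time levels are integers because of the level \<open>-1\<close>.\<close>

definition time_filter ::
  "(int \<Rightarrow> real^'d::finite \<Rightarrow> real^'d) \<Rightarrow> int \<Rightarrow> real^'d \<Rightarrow> real^'d" where
  "time_filter w m x = (3/2) *\<^sub>R w m x - w (m - 1) x + (1/2) *\<^sub>R w (m - 2) x"

definition emac_filtered_solution ::
  "(real^'d::finite) set \<Rightarrow> (real^'d \<Rightarrow> real^'d) set \<Rightarrow> (real^'d \<Rightarrow> real) set \<Rightarrow>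
   real \<Rightarrow> (real \<Rightarrow> real^'d \<Rightarrow> real^'d) \<Rightarrow> real \<Rightarrow> nat \<Rightarrow>
   (int \<Rightarrow> real^'d \<Rightarrow> real^'d) \<Rightarrow> (int \<Rightarrow> real^'d \<Rightarrow> real) \<Rightarrow> bool" where
  "emac_filtered_solution \<Omega> Xh Qh \<nu> f \<Delta>t N u P \<longleftrightarrow>
     (\<forall>n\<in>{0..int N - 1}. u (n + 1) \<in> Xh \<and> P (n + 1) \<in> Qh \<and>
        (\<forall>v\<in>Xh.
           1 / \<Delta>t * L2_inner \<Omega>
             (\<lambda>x. (3/2) *\<^sub>R u (n + 1) x - 2 *\<^sub>R u n x + (1/2) *\<^sub>R u (n - 1) x) v
           + \<nu> * L2_inner \<Omega> (wgrad \<Omega> (time_filter u (n + 1))) (wgrad \<Omega> v)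
           + emac \<Omega> (time_filter u (n + 1)) (time_filter u (n + 1)) v
           - L2_inner \<Omega> (P (n + 1)) (wdiv \<Omega> v)
           = L2_inner \<Omega> (f (real_of_int (n + 1) * \<Delta>t)) v) \<and>
        (\<forall>q\<in>Qh. L2_inner \<Omega> (wdiv \<Omega> (time_filter u (n + 1))) q = 0))"


section \<open>Momentum, angular momentum and the strip\<close>

text \<open>Embedding of \<open>\<real>\<^sup>d\<close> into \<open>\<real>\<^sup>3\<close> along an injective map \<open>\<iota>\<close> of the coordinate
  indices. The usual choices are the identity for \<open>d = 3\<close> and \<open>1 \<mapsto> 1, 2 \<mapsto> 2\<close> for \<open>d = 2\<close>.\<close>

definition embed3 :: "('d \<Rightarrow> 3) \<Rightarrow> real^'d::finite \<Rightarrow> real^3" where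
  "embed3 \<iota> x = (\<Sum>j\<in>UNIV. x $ j *\<^sub>R axis (\<iota> j) 1)"

definition momentum :: "(real^'d::finite) set \<Rightarrow> (real^'d \<Rightarrow> real^'d) \<Rightarrow> real^'d" where
  "momentum \<Omega> u = (LINT x|lebesgue_on \<Omega>. u x)"

definition angular_momentum ::
  "('d \<Rightarrow> 3) \<Rightarrow> (real^'d::finite) set \<Rightarrow> (real^'d \<Rightarrow> real^'d) \<Rightarrow> real^3" where
  "angular_momentum \<iota> \<Omega> u = (LINT x|lebesgue_on \<Omega>. cross3 (embed3 \<iota> (u x)) (embed3 \<iota> x))"

definition boundary_strip :: "(real^'d::finite) set \<Rightarrow> (real^'d) set \<Rightarrow> bool" where
  "boundary_strip \<Omega> \<Omega>s \<longleftrightarrow> \<Omega>s \<subseteq> \<Omega> \<and>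
     (\<exists>\<delta>>0. {x\<in>\<Omega>. infdist x (frontier \<Omega>) < \<delta>} \<subseteq> \<Omega>s)"

definition vanishes_on :: "(real^'d::finite) set \<Rightarrow> (real^'d \<Rightarrow> 'b::euclidean_space) \<Rightarrow> bool" where
  "vanishes_on S f \<longleftrightarrow> (AE x in lebesgue. x \<in> S \<longrightarrow> f x = 0)"

text \<open>Existence of a test function \<open>\<chi>(g)\<close> in \<open>X\<^sub>h\<close> that equals \<open>g\<close> on \<open>\<Omega>\<^sub>i\<close>; its vanishing on
  the boundary is part of \<open>X\<^sub>h \<subseteq> H\<^sub>0\<^sup>1\<close>.\<close>

definition cutoff_available :: "(real^'d \<Rightarrow> real^'d) set \<Rightarrow> (real^'d::finite) set \<Rightarrow>
    (real^'d \<Rightarrow> real^'d) \<Rightarrow> bool" where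
  "cutoff_available Xh \<Omega>i g \<longleftrightarrow> (\<exists>\<chi>g\<in>Xh. AE x in lebesgue. x \<in> \<Omega>i \<longrightarrow> \<chi>g x = g x)"

text \<open>\<open>\<phi>\<close> is the \<open>\<real>\<^sup>d\<close>-valued form of \<open>\<phi>\<^sub>i(x) = x \<times> e\<^sub>i\<close>. For \<open>d = 2\<close> it exists only if \<open>e\<^sub>i\<close>
  is normal to the embedded plane: otherwise \<open>x \<times> e\<^sub>i\<close> leaves the plane, and the corresponding
  component of the angular momentum is identically zero.\<close>

definition is_rotation_field ::
  "('d \<Rightarrow> 3) \<Rightarrow> 3 \<Rightarrow> (real^'d::finite \<Rightarrow> real^'d) \<Rightarrow> bool" where
  "is_rotation_field \<iota> i \<phi> \<longleftrightarrow> (\<forall>x. embed3 \<iota> (\<phi> x) = cross3 (embed3 \<iota> x) (axis i 1))"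

end

theory Submission
  imports Defs
begin

text \<open>A rigid motion field \<open>g(x) = B x + c\<close> with \<open>B\<close> skew-symmetric has vanishing symmetric
  gradient and divergence. Test the scheme with the cutoff of \<open>g\<close>: since the velocity vanishes on
  the strip, it sees only \<open>g\<close>, and two integrations by parts give \<open>c(w, w, g) = 0\<close>. The pressure
  term vanishes because the weak divergence of the cutoff is zero almost everywhere on the open
  set where the piecewise polynomial pressure does not vanish; this locality of weak derivatives
  rests on the fundamental lemma of the calculus of variations. What remains is the recursion
  \<open>3/2 m\<^sub>n\<^sub>+\<^sub>1 - 2 m\<^sub>n + 1/2 m\<^sub>n\<^sub>-\<^sub>1 = 0\<close> for \<open>m\<^sub>n = (u\<^sub>n, g)\<close>, whose solution with equal initial
  values is constant.\<close>

section \<open>Smooth functions and bumps\<close>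

text \<open>The nonlinear identity is a pointwise structure of the EMAC form:
  \<open>2 D(w) w + (div w) w\<close> is the divergence of the symmetric tensor
  \<open>w w^T + (1/2) |w|^2 I\<close>, hence orthogonal to every field whose symmetric gradient
  vanishes, although \<open>w\<close> is divergence free only in the discrete sense. The obstacle is
  that the cutoff is unknown on the strip and that \<open>\<Omega>i\<close> need be neither open nor
  measurable, so that weak derivatives cannot be localised to it. The EMAC form is not affected:
  both of its parts contain the advected velocity undifferentiated, and this factor vanishes on the
  strip. The pressure, however, multiplies a derivative of the cutoff. There the piecewise
  polynomial structure helps: up to element boundaries the set where the pressure is nonzero is
  open, and up to a null set it avoids the strip.\<close>

lemma C_k_const: "C_k k (\<lambda>x::real^'d::finite. c)"
proof (induction k arbitrary: c)
  case (Suc k)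
  have "frechet_derivative (\<lambda>x::real^'d. c) (at x) = (\<lambda>v. 0)" for x
    by (rule frechet_derivative_at[symmetric]) simp
  then show ?case using Suc by simp
qed simp

lemma C_k_SucI:
  assumes "\<And>x. (f has_derivative f' x) (at x)" and "\<And>v. C_k k (\<lambda>x. f' x v)"
  shows "C_k (Suc k) f"
proof -
  have "frechet_derivative f (at x) = f' x" for x
    by (rule frechet_derivative_at[OF assms(1), symmetric])
  moreover have "f differentiable at x" for x
    using assms(1) differentiable_def by blast
  ultimately show ?thesis using assms(2) by simp
qed

lemma C_k_SucD:
  assumes "C_k (Suc k) f"
  shows "(f has_derivative frechet_derivative f (at x)) (at x)"
    and "C_k k (\<lambda>x. frechet_derivative f (at x) v)"
  using assms frechet_derivative_works by auto

lemma C_k_continuous: "C_k k f \<Longrightarrow> continuous_on UNIV f"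
  by (cases k) (auto simp: continuous_on_eq_continuous_at differentiable_imp_continuous_within)

lemma C_k_add:
  assumes "C_k k f" and "C_k k g"
  shows "C_k k (\<lambda>x. f x + g x)"
  using assms
proof (induction k arbitrary: f g)
  case (Suc k)
  show ?case
    by (rule C_k_SucI[OF has_derivative_add[OF C_k_SucD(1)[OF Suc.prems(1)] C_k_SucD(1)[OF Suc.prems(2)]]])
       (intro Suc.IH C_k_SucD(2)[OF Suc.prems(1)] C_k_SucD(2)[OF Suc.prems(2)])
qed (simp add: continuous_on_add)

lemma C_k_Suc_imp: "C_k (Suc k) f \<Longrightarrow> C_k k f"
proof (induction k arbitrary: f)
  case 0
  then show ?case using C_k_continuous[of "Suc 0" f] by simp
next
  case (Suc k)
  show ?case
    by (rule C_k_SucI[OF C_k_SucD(1)[OF Suc.prems]]) (rule Suc.IH[OF C_k_SucD(2)[OF Suc.prems]])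
qed

lemma C_k_mult:
  assumes "C_k k f" and "C_k k g"
  shows "C_k k (\<lambda>x. f x * g x)"
  using assms
proof (induction k arbitrary: f g)
  case (Suc k)
  \<comment> \<open>The derivative of the product still contains the undifferentiated factors; the
    induction hypothesis needs them at order \<open>k\<close>.\<close>
  note lower = C_k_Suc_imp[OF Suc.prems(1)] C_k_Suc_imp[OF Suc.prems(2)]
  show ?case
    by (rule C_k_SucI[OF has_derivative_mult[OF C_k_SucD(1)[OF Suc.prems(1)] C_k_SucD(1)[OF Suc.prems(2)]]])
       (intro C_k_add Suc.IH C_k_SucD(2)[OF Suc.prems(1)] C_k_SucD(2)[OF Suc.prems(2)] lower)
qed (simp add: continuous_on_mult)

lemma C_k_prod:
  assumes "finite I" and "\<And>i. i \<in> I \<Longrightarrow> C_k k (f i)"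
  shows "C_k k (\<lambda>x. \<Prod>i\<in>I. f i x)"
  using assms by (induction I rule: finite_induct) (auto intro: C_k_const C_k_mult)

lemma C_k_affine:
  assumes "bounded_linear L"
  shows "C_k k (\<lambda>x. L x + c)"
proof (cases k)
  case 0
  then show ?thesis
    by (simp add: continuous_on_add linear_continuous_on[OF assms] continuous_on_const)
next
  case (Suc n)
  have "((\<lambda>x. L x + c) has_derivative L) (at x)" for x
    by (rule has_derivative_add_const[OF bounded_linear_imp_has_derivative[OF assms]])
  then show ?thesis unfolding Suc by (rule C_k_SucI) (rule C_k_const)
qed

text \<open>The power of \<open>inverse t\<close> keeps the family closed under differentiation up
  to linear combinations, so smoothness follows by induction on the order for all \<open>m\<close>
  at once.\<close>

definition flat :: "nat \<Rightarrow> real \<Rightarrow> real" where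
  "flat m t = (if t > 0 then inverse t ^ m * exp (- inverse t) else 0)"

lemma flat_tendsto_0: "(flat m \<longlongrightarrow> 0) (at_right 0)"
proof -
  have "((\<lambda>s::real. s ^ m / exp s) \<longlongrightarrow> 0) at_top" by (rule tendsto_power_div_exp_0)
  then have "((\<lambda>t::real. inverse t ^ m / exp (inverse t)) \<longlongrightarrow> 0) (at_right 0)"
    by (rule filterlim_compose[OF _ filterlim_inverse_at_top_right])
  then show ?thesis
    by (rule Lim_transform_eventually)
       (auto simp: eventually_at_right_less flat_def exp_minus divide_simps
          intro!: eventually_at_rightI[of 0 1])
qed

lemma flat_has_derivative:
  "(flat m has_real_derivative (flat (m + 2) t - real m * flat (m + 1) t)) (at t)"
proof (cases t "0::real" rule: linorder_cases)
  case less
  have "((\<lambda>t. 0) has_real_derivative 0) (at t)" by simp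
  then have "(flat m has_real_derivative 0) (at t)"
    by (rule has_field_derivative_transform_within_open[of _ _ _ "{..<0}"]) (use less in \<open>auto simp: flat_def\<close>)
  then show ?thesis using less by (simp add: flat_def)
next
  case greater
  have "((\<lambda>s. s ^ m * exp (- s)) has_real_derivative
      (real m * s ^ (m - 1) - s ^ m) * exp (- s)) (at s)" for s :: real
    by (auto intro!: derivative_eq_intros simp: left_diff_distrib)
  from DERIV_chain2[OF this DERIV_inverse[of t]] greater
  have "((\<lambda>t. inverse t ^ m * exp (- inverse t)) has_real_derivative
      (real m * inverse t ^ (m - 1) - inverse t ^ m) * exp (- inverse t) * - (inverse t ^ Suc (Suc 0))) (at t)"
    by simp
  also have "(real m * inverse t ^ (m - 1) - inverse t ^ m) * exp (- inverse t) * - (inverse t ^ Suc (Suc 0))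
      = flat (m + 2) t - real m * flat (m + 1) t"
    using greater by (cases m) (simp_all add: flat_def left_diff_distrib right_diff_distrib mult_ac)
  finally have "((\<lambda>t. inverse t ^ m * exp (- inverse t)) has_real_derivative
      (flat (m + 2) t - real m * flat (m + 1) t)) (at t)" .
  then show ?thesis
    by (rule has_field_derivative_transform_within_open[of _ _ _ "{0<..}"]) (use greater in \<open>auto simp: flat_def\<close>)
next
  case equal
  \<comment> \<open>For positive \<open>y\<close> the quotient is \<open>flat (m + 1) y\<close>,
    which tends to 0; from the left it is 0.\<close>
  have 1: "((\<lambda>y. (flat m y - flat m 0) / (y - 0)) \<longlongrightarrow> 0) (at_right 0)"
    by (rule Lim_transform_eventually[OF flat_tendsto_0[of "m+1"]])
       (auto simp: flat_def field_simps intro!: eventually_at_rightI[of 0 1])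
  have 2: "((\<lambda>y. (flat m y - flat m 0) / (y - 0)) \<longlongrightarrow> 0) (at_left 0)"
    by (rule Lim_transform_eventually[OF tendsto_const])
       (auto simp: flat_def field_simps intro!: eventually_at_leftI[of "-1"])
  have "(flat m has_real_derivative 0) (at 0)"
    unfolding has_field_derivative_iff using 1 2 by (simp add: filterlim_at_split)
  then show ?thesis using equal by (simp add: flat_def)
qed

lemma C_k_flat:
  assumes "bounded_linear L"
  shows "C_k k (\<lambda>x. flat m (L x + c))"
proof (induction k arbitrary: m)
  case 0
  have "continuous_on UNIV (flat m)"
    using DERIV_continuous_on[OF has_field_derivative_at_within[OF flat_has_derivative]] .
  moreover have "continuous_on UNIV (\<lambda>x. L x + c)"
    by (intro continuous_on_add linear_continuous_on[OF assms] continuous_on_const)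
  ultimately show ?case
    using continuous_on_compose2[of UNIV "flat m" UNIV "\<lambda>x. L x + c"] by simp
next
  case (Suc k)
  have "((\<lambda>x. flat m (L x + c)) has_derivative
      (\<lambda>v. L v * (flat (m + 2) (L x + c) + (- real m) * flat (m + 1) (L x + c)))) (at x)" for x
    by (rule has_derivative_eq_rhs[OF DERIV_compose_FDERIV[OF flat_has_derivative
            has_derivative_add_const[OF bounded_linear_imp_has_derivative[OF assms]]]])
       simp
  then show ?case
    by (rule C_k_SucI) (intro C_k_mult C_k_add C_k_const Suc.IH)
qed

text \<open>The factor \<open>m\<close> inside the arguments drives every factor
  \<open>exp (-1 / (m s))\<close> to 1, so the bumps tend to the indicator of the open box while
  their supports stay in the closed one.\<close>

definition box_bump :: "nat \<Rightarrow> real^'d::finite \<Rightarrow> real^'d \<Rightarrow> real^'d \<Rightarrow> real" where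
  "box_bump m a b x = (\<Prod>i\<in>UNIV. flat 0 (real m * (x $ i - a $ i)) * flat 0 (real m * (b $ i - x $ i)))"

lemma flat_0_bounds: "0 \<le> flat 0 t" "flat 0 t \<le> 1"
  by (auto simp: flat_def)

lemma box_bump_bounds: "0 \<le> box_bump m a b x" "box_bump m a b x \<le> 1"
  by (auto simp: box_bump_def flat_0_bounds intro!: prod_nonneg prod_le_1 mult_le_one)

lemma box_bump_eq_0:
  assumes "x \<notin> box a b"
  shows "box_bump m a b x = 0"
proof -
  obtain i where "x $ i \<le> a $ i \<or> b $ i \<le> x $ i"
    using assms by (auto simp: mem_box_cart not_less)
  then have "flat 0 (real m * (x $ i - a $ i)) * flat 0 (real m * (b $ i - x $ i)) = 0"
    by (auto simp: flat_def zero_less_mult_iff)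
  then show ?thesis unfolding box_bump_def by (intro prod_zero) auto
qed

lemma C_k_box_bump: "C_k k (box_bump m a (b::real^'d::finite))"
proof -
  have L: "bounded_linear (\<lambda>x::real^'d. c * x $ i)" for c i
    by (intro bounded_linear_const_mult bounded_linear_vec_nth)
  have 1: "C_k k (\<lambda>x::real^'d. flat 0 (real m * (x $ i - a $ i)))" for i
    using C_k_flat[OF L[of "real m" i], of k 0 "- real m * a $ i"] by (simp add: algebra_simps)
  have 2: "C_k k (\<lambda>x::real^'d. flat 0 (real m * (b $ i - x $ i)))" for i
    using C_k_flat[OF L[of "- real m" i], of k 0 "real m * b $ i"] by (simp add: algebra_simps)
  show ?thesis unfolding box_bump_def by (intro C_k_prod C_k_mult 1 2) simp
qed

lemma box_bump_test_function:
  assumes "cbox a b \<subseteq> U"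
  shows "box_bump m a b \<in> test_functions U"
proof -
  have "{x. box_bump m a b x \<noteq> 0} \<subseteq> cbox a b"
    using box_bump_eq_0[of _ a b m] box_subset_cbox[of a b] by blast
  then have *: "closure {x. box_bump m a b x \<noteq> 0} \<subseteq> cbox a b"
    by (simp add: closure_minimal closed_cbox)
  then have "compact (closure {x. box_bump m a b x \<noteq> 0})"
    using bounded_subset[OF bounded_cbox *] by (simp add: compact_eq_bounded_closed)
  with assms * show ?thesis
    by (auto simp: test_functions_def C_k_box_bump)
qed

lemma box_bump_tendsto: "(\<lambda>m. box_bump m a b x) \<longlonglongrightarrow> indicator (box a b) x"
proof (cases "x \<in> box a b")
  case True
  have *: "(\<lambda>m. flat 0 (real m * t)) \<longlonglongrightarrow> 1" if "t > 0" for t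
  proof -
    \<comment> \<open>At \<open>m = 0\<close> this exponential is 1, since
      \<open>inverse 0 = 0\<close>, whereas \<open>flat 0 0 = 0\<close>; the two sequences agree
      only from \<open>m = 1\<close> on.\<close>
    have "(\<lambda>m. exp (- inverse (real m) * inverse t)) \<longlonglongrightarrow> exp (- 0 * inverse t)"
      by (intro tendsto_intros lim_inverse_n)
    then have "(\<lambda>m. exp (- inverse (real m) * inverse t)) \<longlonglongrightarrow> 1" by simp
    then show ?thesis
      by (rule Lim_transform_eventually)
         (auto intro!: eventually_sequentiallyI[of 1] simp: flat_def that)
  qed
  have "(\<lambda>m. box_bump m a b x) \<longlonglongrightarrow> (\<Prod>i\<in>(UNIV::'a set). 1 * 1)"
    unfolding box_bump_def using True
    by (intro tendsto_prod tendsto_mult *) (auto simp: mem_box_cart)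
  with True show ?thesis by simp
qed (simp add: box_bump_eq_0)

section \<open>Test functions\<close>

lemma test_functions_C_k: "\<phi> \<in> test_functions \<Omega> \<Longrightarrow> C_k k \<phi>"
  by (simp add: test_functions_def)

lemma test_functions_continuous: "\<phi> \<in> test_functions \<Omega> \<Longrightarrow> continuous_on UNIV \<phi>"
  using test_functions_C_k C_k_continuous by blast

lemma test_functions_has_derivative:
  "\<phi> \<in> test_functions \<Omega> \<Longrightarrow> (\<phi> has_derivative frechet_derivative \<phi> (at x)) (at x)"
  using C_k_SucD(1)[OF test_functions_C_k] .

lemma test_functions_continuous_partial:
  "\<phi> \<in> test_functions \<Omega> \<Longrightarrow> continuous_on UNIV (partial j \<phi>)"
  using C_k_SucD(2)[OF test_functions_C_k, of \<phi> \<Omega> 0 "axis j 1"]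
  by (simp add: partial_def[abs_def])

lemma test_functions_mono: "\<phi> \<in> test_functions U \<Longrightarrow> U \<subseteq> \<Omega> \<Longrightarrow> \<phi> \<in> test_functions \<Omega>"
  by (auto simp: test_functions_def)

lemma test_functions_eq_0: "\<phi> \<in> test_functions \<Omega> \<Longrightarrow> x \<notin> \<Omega> \<Longrightarrow> \<phi> x = 0"
  using closure_subset[of "{x. \<phi> x \<noteq> 0}"] by (auto simp: test_functions_def)

lemma partial_eq_0:
  assumes "x \<notin> closure {x. \<phi> x \<noteq> 0}"
  shows "partial j \<phi> x = 0"
proof -
  have "((\<lambda>x. 0) has_derivative (\<lambda>v. 0)) (at x)" by simp
  then have "(\<phi> has_derivative (\<lambda>v. 0)) (at x)"
    by (rule has_derivative_transform_within_open[of _ _ _ _ "- closure {x. \<phi> x \<noteq> 0}"])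
       (use assms closure_subset[of "{x. \<phi> x \<noteq> 0}"] in \<open>auto\<close>)
  then show ?thesis by (simp add: partial_def frechet_derivative_at[symmetric])
qed

lemma test_functions_partial_eq_0: "\<phi> \<in> test_functions \<Omega> \<Longrightarrow> x \<notin> \<Omega> \<Longrightarrow> partial j \<phi> x = 0"
  by (rule partial_eq_0) (auto simp: test_functions_def)

lemma compact_support_bounded:
  fixes f :: "real^'d::finite \<Rightarrow> real"
  assumes "continuous_on UNIV f" and "compact S" and "\<And>x. x \<notin> S \<Longrightarrow> f x = 0"
  obtains M where "M \<ge> 0" "\<And>x. \<bar>f x\<bar> \<le> M"
proof -
  have "bounded (f ` S)"
    by (intro compact_imp_bounded compact_continuous_image assms continuous_on_subset[OF assms(1)]) simp
  then obtain M where "\<And>x. x \<in> S \<Longrightarrow> \<bar>f x\<bar> \<le> M" by (auto simp: bounded_iff)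
  then have "\<bar>f x\<bar> \<le> max M 0" for x using assms(3)[of x] by (cases "x \<in> S") fastforce+
  then show ?thesis by (intro that[of "max M 0"]) auto
qed

lemma test_functions_bounded:
  assumes "\<phi> \<in> test_functions \<Omega>"
  obtains M where "M \<ge> 0" "\<And>x. \<bar>\<phi> x\<bar> \<le> M"
proof (rule compact_support_bounded)
  show "continuous_on UNIV \<phi>" by (rule test_functions_continuous[OF assms])
  show "compact (closure {x. \<phi> x \<noteq> 0})" using assms by (simp add: test_functions_def)
  show "\<phi> x = 0" if "x \<notin> closure {x. \<phi> x \<noteq> 0}" for x
    using that closure_subset[of "{x. \<phi> x \<noteq> 0}"] by blast
qed (rule that)

lemma test_functions_partial_bounded:
  assumes "\<phi> \<in> test_functions \<Omega>"
  obtains M where "M \<ge> 0" "\<And>x. \<bar>partial j \<phi> x\<bar> \<le> M"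
proof (rule compact_support_bounded)
  show "continuous_on UNIV (partial j \<phi>)" by (rule test_functions_continuous_partial[OF assms])
  show "compact (closure {x. \<phi> x \<noteq> 0})" using assms by (simp add: test_functions_def)
  show "partial j \<phi> x = 0" if "x \<notin> closure {x. \<phi> x \<noteq> 0}" for x
    by (rule partial_eq_0[OF that])
qed (rule that)

lemma has_real_derivative_partial:
  assumes "\<phi> \<in> test_functions \<Omega>"
  shows "((\<lambda>s. \<phi> (x + s *\<^sub>R axis j 1)) has_real_derivative partial j \<phi> (x + s *\<^sub>R axis j 1)) (at s)"
proof -
  let ?D = "frechet_derivative \<phi> (at (x + s *\<^sub>R axis j 1))"
  have "((\<lambda>s. x + s *\<^sub>R axis j 1) has_derivative (\<lambda>h. h *\<^sub>R axis j 1)) (at s)"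
    by (auto intro!: derivative_eq_intros)
  from has_derivative_compose[OF this test_functions_has_derivative[OF assms]]
  have "((\<lambda>s. \<phi> (x + s *\<^sub>R axis j 1)) has_derivative (\<lambda>h. ?D (h *\<^sub>R axis j 1))) (at s)" .
  moreover have "linear ?D"
    using test_functions_has_derivative[OF assms] has_derivative_linear by blast
  ultimately show ?thesis
    unfolding has_field_derivative_def partial_def
    by (elim has_derivative_eq_rhs) (simp add: fun_eq_iff linear_cmul mult.commute)
qed

section \<open>Integrals of partial derivatives of test functions\<close>

lemma lborel_integral_translation:
  fixes f :: "'a::euclidean_space \<Rightarrow> real"
  assumes "f \<in> borel_measurable borel"
  shows "(LINT x|lborel. f (x + c)) = (LINT x|lborel. f x)"
proof -
  have "(LINT x|lborel. f x) = (LINT x|distr lborel borel ((+) c). f x)"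
    by (simp add: lborel_distr_plus)
  also have "\<dots> = (LINT x|lborel. f (c + x))"
    using assms by (subst integral_distr) auto
  finally show ?thesis by (simp add: add.commute)
qed

lemma lborel_integrable_compact_support:
  fixes f :: "real^'d::finite \<Rightarrow> real"
  assumes "f \<in> borel_measurable borel" and "\<And>x. \<bar>f x\<bar> \<le> M" and "\<And>x. norm x > R \<Longrightarrow> f x = 0"
  shows "integrable lborel f"
proof (rule Bochner_Integration.integrable_bound)
  show "integrable lborel (\<lambda>x::real^'d. M * indicator (cball 0 R) x)"
    by (intro integrable_mult_right integrable_real_indicator)
       (use emeasure_bounded_finite[OF bounded_cball] in \<open>auto simp: top.not_eq_extremum\<close>)
  show "AE x in lborel. norm (f x) \<le> norm (M * indicator (cball 0 R) x)"
    using assms(2) assms(3) by (auto simp: indicator_def not_le intro!: AE_I2) (meson abs_ge_self order_trans)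
qed (use assms(1) in simp)

text \<open>The difference quotients of \<open>\<phi>\<close> have integral zero by translation invariance.\<close>

lemma test_functions_integral_partial:
  assumes \<phi>: "\<phi> \<in> test_functions (\<Omega> :: (real^'d::finite) set)" and \<Omega>: "\<Omega> \<in> sets lebesgue"
  shows "(LINT x|lebesgue_on \<Omega>. partial j \<phi> x) = 0"
proof -
  let ?e = "axis j 1 :: real^'d"
  \<comment> \<open>Step lengths at most 1 keep all shifted supports in the ball of radius
    \<open>R + 1\<close>, which gives one dominating function.\<close>
  define t where "t n = inverse (real (Suc n))" for n
  have t: "0 < t n" "t n \<le> 1" for n by (auto simp: t_def inverse_le_1_iff)
  define q where "q n x = (\<phi> (x + t n *\<^sub>R ?e) - \<phi> x) / t n" for n x
  have \<phi>m[measurable]: "\<phi> \<in> borel_measurable borel"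
    by (intro borel_measurable_continuous_onI test_functions_continuous[OF \<phi>])
  have pm[measurable]: "partial j \<phi> \<in> borel_measurable borel"
    by (intro borel_measurable_continuous_onI test_functions_continuous_partial[OF \<phi>])
  obtain R where R: "\<And>x. \<phi> x \<noteq> 0 \<Longrightarrow> norm x \<le> R"
  proof -
    have "bounded (closure {x. \<phi> x \<noteq> 0})"
      using \<phi> by (auto simp: test_functions_def compact_imp_bounded)
    then show ?thesis using closure_subset[of "{x. \<phi> x \<noteq> 0}"] that by (fastforce simp: bounded_iff)
  qed
  obtain K where K: "K \<ge> 0" "\<And>x. \<bar>\<phi> x\<bar> \<le> K" using test_functions_bounded[OF \<phi>] by blast
  obtain M where M: "M \<ge> 0" "\<And>x. \<bar>partial j \<phi> x\<bar> \<le> M"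
    using test_functions_partial_bounded[OF \<phi>] by blast
  have \<phi>_int: "integrable lborel \<phi>"
    by (rule lborel_integrable_compact_support[of _ K R]) (use K R in \<open>auto simp: linorder_not_le dest: leD\<close>)
  have \<phi>_int': "integrable lborel (\<lambda>x. \<phi> (x + c))" if "norm c \<le> 1" for c
  proof (rule lborel_integrable_compact_support[of _ K "R + 1"])
    fix x :: "real^'d" assume "R + 1 < norm x"
    moreover have "norm x \<le> norm (x + c) + norm c" using norm_triangle_ineq4[of "x + c" c] by simp
    ultimately have "R < norm (x + c)" using that by simp
    then show "\<phi> (x + c) = 0" using R[of "x + c"] by linarith
  qed (use K in auto)
  have q0: "(LINT x|lborel. q n x) = 0" for n
  proof -
    have "integrable lborel (\<lambda>x. \<phi> (x + t n *\<^sub>R ?e))"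
      by (rule \<phi>_int') (use t[of n] in \<open>simp add: norm_axis_1\<close>)
    then show ?thesis
      unfolding q_def using \<phi>_int lborel_integral_translation[OF \<phi>m, of "t n *\<^sub>R ?e"] by simp
  qed
  \<comment> \<open>The mean value theorem bounds the difference quotients by the bound of the
    partial derivative, uniformly in \<open>n\<close>.\<close>
  have q_mvt: "\<exists>s. 0 < s \<and> s < t n \<and> q n x = partial j \<phi> (x + s *\<^sub>R ?e)" for n x
  proof -
    have "\<exists>z. 0 < z \<and> z < t n \<and> \<phi> (x + t n *\<^sub>R ?e) - \<phi> (x + 0 *\<^sub>R ?e) =
        (t n - 0) * partial j \<phi> (x + z *\<^sub>R ?e)"
      by (rule MVT2[OF t(1)]) (rule has_real_derivative_partial[OF \<phi>])
    then obtain z where "0 < z" "z < t n" "\<phi> (x + t n *\<^sub>R ?e) - \<phi> x = t n * partial j \<phi> (x + z *\<^sub>R ?e)"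
      by auto
    then show ?thesis using t(1)[of n] by (intro exI[of _ z]) (auto simp: q_def)
  qed
  have q_lim: "(\<lambda>n. q n x) \<longlonglongrightarrow> partial j \<phi> x" for x
  proof -
    have "((\<lambda>h. (\<phi> (x + (0 + h) *\<^sub>R ?e) - \<phi> (x + 0 *\<^sub>R ?e)) / h) \<longlongrightarrow> partial j \<phi> (x + 0 *\<^sub>R ?e)) (at 0)"
      using has_real_derivative_partial[OF \<phi>, of x j 0] unfolding DERIV_def .
    moreover have "filterlim t (at 0) sequentially"
      unfolding filterlim_at using LIMSEQ_inverse_real_of_nat t(1)
      by (auto simp: t_def[abs_def] less_imp_neq[symmetric])
    ultimately have "(\<lambda>n. (\<phi> (x + (0 + t n) *\<^sub>R ?e) - \<phi> (x + 0 *\<^sub>R ?e)) / t n) \<longlonglongrightarrow> partial j \<phi> (x + 0 *\<^sub>R ?e)"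
      by (rule filterlim_compose)
    then show ?thesis by (simp add: q_def)
  qed
  have w: "integrable lborel (\<lambda>x::real^'d. M * indicator (cball 0 (R + 1)) x)"
    by (intro integrable_mult_right integrable_real_indicator)
       (use emeasure_bounded_finite[OF bounded_cball] in \<open>auto simp: top.not_eq_extremum\<close>)
  have bound: "norm (q n x) \<le> M * indicator (cball 0 (R + 1)) x" for n x
  proof (cases "norm x \<le> R + 1")
    case True
    with q_mvt[of n x] M(2) show ?thesis by (auto simp: indicator_def)
  next
    case False
    have "norm x \<le> norm (x + t n *\<^sub>R ?e) + t n"
      using norm_triangle_ineq4[of "x + t n *\<^sub>R ?e" "t n *\<^sub>R ?e"] t(1)[of n] by (simp add: norm_axis_1)
    with False t(2)[of n] have "R < norm (x + t n *\<^sub>R ?e)" "R < norm x" by auto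
    then have "\<phi> x = 0" "\<phi> (x + t n *\<^sub>R ?e) = 0" using R not_le by blast+
    then have "q n x = 0" by (simp add: q_def)
    then show ?thesis using M(1) by simp
  qed
  have "(\<lambda>n. LINT x|lborel. q n x) \<longlonglongrightarrow> (LINT x|lborel. partial j \<phi> x)"
    by (rule integral_dominated_convergence[OF _ _ w])
       (use bound q_lim in \<open>auto simp: q_def[abs_def] simp del: real_norm_def\<close>)
  then have "(LINT x|lborel. partial j \<phi> x) = 0"
    unfolding q0 using LIMSEQ_unique tendsto_const by blast
  moreover have "(LINT x|lborel. partial j \<phi> x) = (LINT x|lebesgue. partial j \<phi> x)"
    by (rule integral_completion[symmetric]) simp
  moreover have "(LINT x|lebesgue. partial j \<phi> x) = (LINT x|lebesgue. (if x \<in> \<Omega> then partial j \<phi> x else 0))"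
    by (rule Bochner_Integration.integral_cong) (auto simp: test_functions_partial_eq_0[OF \<phi>])
  ultimately show ?thesis by (simp add: Lebesgue_Measure.integral_restrict_UNIV[OF \<Omega>])
qed

section \<open>The fundamental lemma of the calculus of variations\<close>

lemma integrable_lebesgue_on_subset:
  fixes f :: "'a::euclidean_space \<Rightarrow> real"
  assumes "integrable (lebesgue_on T) f" "S \<subseteq> T" "S \<in> sets lebesgue" "T \<in> sets lebesgue"
  shows "integrable (lebesgue_on S) f"
proof -
  have "integrable lebesgue (\<lambda>x. indicator S x *\<^sub>R (if x \<in> T then f x else 0))"
    by (intro integrable_mult_indicator assms(3)) (simp add: Lebesgue_Measure.integrable_restrict_UNIV[OF assms(4)] assms(1))
  also have "(\<lambda>x. indicator S x *\<^sub>R (if x \<in> T then f x else 0)) = (\<lambda>x. if x \<in> S then f x else 0)"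
    using assms(2) by (auto simp: fun_eq_iff)
  finally show ?thesis by (simp add: Lebesgue_Measure.integrable_restrict_UNIV[OF assms(3)])
qed

text \<open>The bumps converge to the indicator of the open box and lie between 0 and 1, so
  dominated convergence with \<open>|f|\<close> applies; the boundary of the box is a null
  set.\<close>

lemma orthogonal_test_functions_integral_cbox:
  fixes f :: "real^'d::finite \<Rightarrow> real"
  assumes f: "integrable (lebesgue_on U) f" and U: "U \<in> sets lebesgue"
    and orth: "\<And>\<phi>. \<phi> \<in> test_functions U \<Longrightarrow> (LINT x|lebesgue_on U. f x * \<phi> x) = 0"
    and ab: "cbox a b \<subseteq> U"
  shows "integral (cbox a b) f = 0"
proof -
  have [measurable]: "f \<in> borel_measurable (lebesgue_on U)" using f by auto
  have box: "box a b \<subseteq> U" using ab box_subset_cbox by blast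
  have bump: "box_bump m a b \<in> borel_measurable (lebesgue_on U)" for m
    by (intro continuous_imp_measurable_on_sets_lebesgue U continuous_on_subset[OF C_k_continuous[OF C_k_box_bump]]) auto
  have "(\<lambda>m. LINT x|lebesgue_on U. f x * box_bump m a b x) \<longlonglongrightarrow>
      (LINT x|lebesgue_on U. f x * indicator (box a b) x)"
  proof (rule integral_dominated_convergence[where w="\<lambda>x. norm (f x)"])
    show "(\<lambda>x. f x * indicat_real (box a b) x) \<in> borel_measurable (lebesgue_on U)"
      by (intro borel_measurable_times borel_measurable_indicator \<open>f \<in> _\<close>)
         (auto simp: sets_restrict_space_iff U box)
    show "(\<lambda>x. f x * box_bump m a b x) \<in> borel_measurable (lebesgue_on U)" for m
      by (intro borel_measurable_times bump \<open>f \<in> _\<close>)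
    show "integrable (lebesgue_on U) (\<lambda>x. norm (f x))" using f by simp
    show "AE x in lebesgue_on U. (\<lambda>m. f x * box_bump m a b x) \<longlonglongrightarrow> f x * indicator (box a b) x"
      by (intro AE_I2 tendsto_mult tendsto_const box_bump_tendsto)
    show "AE x in lebesgue_on U. norm (f x * box_bump m a b x) \<le> norm (f x)" for m
      by (rule AE_I2) (auto simp: abs_mult box_bump_bounds intro!: mult_left_le)
  qed
  then have "(LINT x|lebesgue_on U. f x * indicator (box a b) x) = 0"
    by (simp add: orth[OF box_bump_test_function[OF ab]] LIMSEQ_const_iff)
  also have "(\<lambda>x. f x * indicator (box a b) x) = (\<lambda>x. if x \<in> box a b then f x else 0)"
    by auto
  finally have "(LINT x|lebesgue_on (box a b). f x) = 0"
    using integral_restrict[OF box _ U, of f] by simp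
  moreover have "integrable (lebesgue_on (box a b)) f"
    by (rule integrable_lebesgue_on_subset[OF f box _ U]) simp
  ultimately show ?thesis
    by (simp add: lebesgue_integral_eq_integral integral_open_interval)
qed

text \<open>Integrals over all boxes in \<open>U\<close> vanish, and by Lebesgue differentiation
  \<open>f\<close> is almost everywhere a limit of averages over shrinking boxes.\<close>

lemma orthogonal_test_functions_AE_0:
  fixes f :: "real^'d::finite \<Rightarrow> real"
  assumes f: "integrable (lebesgue_on U) f" and U: "open U"
    and orth: "\<And>\<phi>. \<phi> \<in> test_functions U \<Longrightarrow> (LINT x|lebesgue_on U. f x * \<phi> x) = 0"
  shows "AE x in lebesgue. x \<in> U \<longrightarrow> f x = 0"
proof -
  have Um: "U \<in> sets lebesgue" using U by (simp add: borel_open)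
  have local: "AE x in lebesgue. x \<in> cbox c d \<longrightarrow> f x = 0" if cd: "cbox c d \<subseteq> U" for c d
  proof -
    \<comment> \<open>Extension by zero from one box gives a function on the whole space whose
      integrals over all boxes vanish, because the intersection of two boxes is again a box.\<close>
    define G where "G x = (if x \<in> cbox c d then f x else 0)" for x
    have "f integrable_on cbox c d"
      by (rule integrable_on_lebesgue_on[OF integrable_lebesgue_on_subset[OF f cd _ Um]]) auto
    then have "G integrable_on UNIV" by (simp add: G_def[abs_def] Henstock_Kurzweil_Integration.integrable_restrict_UNIV)
    then have G: "G integrable_on cbox a b" for a b by (rule integrable_on_subcbox) simp
    have G0: "integral (cbox a b) G = 0" for a b
    proof -
      have "integral (cbox a b) G = integral (cbox c d \<inter> cbox a b) f"
        by (simp add: G_def[abs_def] Henstock_Kurzweil_Integration.integral_restrict_Int)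
      also have "\<dots> = 0"
        unfolding Int_interval
        by (rule orthogonal_test_functions_integral_cbox[OF f Um orth])
           (use cd in \<open>auto simp: Int_interval[symmetric]\<close>)
      finally show ?thesis .
    qed
    \<comment> \<open>The differentiation theorem, with averages over cubes having \<open>x\<close>
      as their lower corner.\<close>
    obtain N where N: "negligible N" "\<And>x e. \<lbrakk>x \<notin> N; 0 < e\<rbrakk> \<Longrightarrow>
        \<exists>\<delta>>0. \<forall>h. 0 < h \<and> h < \<delta> \<longrightarrow>
          norm (integral (cbox x (x + h *\<^sub>R One)) G /\<^sub>R h ^ DIM(real^'d) - G x) < e"
      using integrable_ccontinuous_explicit[OF G] by blast
    have "G x = 0" if x: "x \<notin> N" for x
    proof (rule ccontr)
      assume "G x \<noteq> 0"
      then obtain \<delta> where "\<delta> > 0" "\<And>h. 0 < h \<Longrightarrow> h < \<delta> \<Longrightarrow>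
          norm (integral (cbox x (x + h *\<^sub>R One)) G /\<^sub>R h ^ DIM(real^'d) - G x) < \<bar>G x\<bar>"
        using N(2)[OF x, of "\<bar>G x\<bar>"] by auto
      from this(2)[of "\<delta> / 2"] this(1) show False by (simp add: G0)
    qed
    then have "AE x in lebesgue. G x = 0"
      using N(1) by (intro AE_I'[of N]) (auto simp: negligible_iff_null_sets)
    then show ?thesis by eventually_elim (auto simp: G_def split: if_splits)
  qed
  \<comment> \<open>Countably many closed boxes exhaust \<open>U\<close>, so their exceptional null
    sets unite to a null set.\<close>
  have "\<exists>\<D>. countable \<D> \<and> \<D> \<subseteq> Pow U \<and> (\<forall>X\<in>\<D>. \<exists>a b. X = cbox a b) \<and> \<Union>\<D> = U"
    by (rule open_countable_Union_open_cbox[OF U], rule exI, intro conjI ballI) assumption+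
  then obtain \<D> where \<D>: "countable \<D>" "\<D> \<subseteq> Pow U" "\<forall>X\<in>\<D>. \<exists>a b. X = cbox a b" "\<Union>\<D> = U"
    by blast
  have "\<forall>X\<in>\<D>. AE x in lebesgue. x \<in> X \<longrightarrow> f x = 0"
  proof
    fix X assume X: "X \<in> \<D>"
    with \<D>(3) obtain a b where ab: "X = cbox a b" by blast
    have "X \<subseteq> U" using \<D>(2) X by blast
    with local[of a b] show "AE x in lebesgue. x \<in> X \<longrightarrow> f x = 0" unfolding ab .
  qed
  then have "AE x in lebesgue. \<forall>X\<in>\<D>. x \<in> X \<longrightarrow> f x = 0"
    by (subst AE_ball_countable[OF \<D>(1)])
  then show ?thesis by (rule AE_mp) (use \<D>(4) in \<open>auto intro!: AE_I2\<close>)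
qed

section \<open>Weak derivatives and integration by parts\<close>

text \<open>Weak derivatives are tested with test functions only; an affine weight has to be
  absorbed into the test function.\<close>

lemma test_functions_mult_affine:
  assumes \<phi>: "\<phi> \<in> test_functions U" and L: "bounded_linear L"
  shows "(\<lambda>x. \<phi> x * (L x + c)) \<in> test_functions U"
proof -
  have sub: "closure {x. \<phi> x * (L x + c) \<noteq> 0} \<subseteq> closure {x. \<phi> x \<noteq> 0}"
    by (rule closure_mono) auto
  moreover have "bounded (closure {x. \<phi> x * (L x + c) \<noteq> 0})"
    by (rule bounded_subset[OF _ sub]) (use \<phi> in \<open>auto simp: test_functions_def compact_imp_bounded\<close>)
  moreover have "C_k k (\<lambda>x. \<phi> x * (L x + c))" for k
    by (intro C_k_mult C_k_affine L test_functions_C_k[OF \<phi>])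
  ultimately show ?thesis
    using \<phi> subset_trans[OF sub] by (simp add: test_functions_def compact_eq_bounded_closed)
qed

lemma partial_mult_affine:
  assumes \<phi>: "\<phi> \<in> test_functions U" and L: "bounded_linear L"
  shows "partial j (\<lambda>x. \<phi> x * (L x + c)) x = partial j \<phi> x * (L x + c) + \<phi> x * L (axis j 1)"
proof -
  have "((\<lambda>x. L x + c) has_derivative L) (at x)"
    by (rule has_derivative_add_const[OF bounded_linear_imp_has_derivative[OF L]])
  from fun_cong[OF frechet_derivative_at[OF has_derivative_mult[OF test_functions_has_derivative[OF \<phi>] this]],
      of "axis j 1"]
  show ?thesis by (simp add: partial_def)
qed

section \<open>Square integrable functions and the Cauchy-Schwarz inequality\<close>

lemma L2_real_iff:
  "(f :: real^'d::finite \<Rightarrow> real) \<in> L2 \<Omega> \<longleftrightarrow>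
    f \<in> borel_measurable (lebesgue_on \<Omega>) \<and> integrable (lebesgue_on \<Omega>) (\<lambda>x. (f x)\<^sup>2)"
  by (simp add: L2_def)

lemma L2_mult_integrable:
  fixes f g :: "real^'d::finite \<Rightarrow> real"
  assumes "f \<in> L2 \<Omega>" and "g \<in> L2 \<Omega>"
  shows "integrable (lebesgue_on \<Omega>) (\<lambda>x. f x * g x)"
proof (rule Bochner_Integration.integrable_bound)
  show "integrable (lebesgue_on \<Omega>) (\<lambda>x. (f x)\<^sup>2 + (g x)\<^sup>2)"
    using assms by (simp add: L2_real_iff)
  show "(\<lambda>x. f x * g x) \<in> borel_measurable (lebesgue_on \<Omega>)"
    using assms by (auto simp: L2_real_iff)
  have "\<bar>a * b\<bar> \<le> \<bar>a\<^sup>2 + b\<^sup>2\<bar>" for a b :: real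
  proof -
    have "2 * (\<bar>a\<bar> * \<bar>b\<bar>) \<le> a\<^sup>2 + b\<^sup>2" using sum_squares_bound[of "\<bar>a\<bar>" "\<bar>b\<bar>"] by simp
    then have "2 * \<bar>a * b\<bar> \<le> a\<^sup>2 + b\<^sup>2" by (simp add: abs_mult)
    then show ?thesis using abs_ge_zero[of "a * b"] by linarith
  qed
  then show "AE x in lebesgue_on \<Omega>. norm (f x * g x) \<le> norm ((f x)\<^sup>2 + (g x)\<^sup>2)"
    by simp
qed

lemma L2_scale:
  fixes f :: "real^'d::finite \<Rightarrow> real"
  assumes "f \<in> L2 \<Omega>"
  shows "(\<lambda>x. c * f x) \<in> L2 \<Omega>"
  using assms by (auto simp: L2_real_iff power_mult_distrib)

lemma L2_add:
  fixes f g :: "real^'d::finite \<Rightarrow> real"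
  assumes "f \<in> L2 \<Omega>" and "g \<in> L2 \<Omega>"
  shows "(\<lambda>x. f x + g x) \<in> L2 \<Omega>"
proof -
  have "(\<lambda>x. (f x + g x)\<^sup>2) = (\<lambda>x. (f x)\<^sup>2 + (g x)\<^sup>2 + 2 * (f x * g x))"
    by (simp add: fun_eq_iff power2_sum)
  then show ?thesis
    using assms L2_mult_integrable[OF assms] by (auto simp: L2_real_iff)
qed

lemma L2_diff:
  fixes f g :: "real^'d::finite \<Rightarrow> real"
  assumes "f \<in> L2 \<Omega>" and "g \<in> L2 \<Omega>"
  shows "(\<lambda>x. f x - g x) \<in> L2 \<Omega>"
  using L2_add[OF assms(1) L2_scale[OF assms(2), of "-1"]] by simp

lemma L2_mult_bounded:
  fixes f g :: "real^'d::finite \<Rightarrow> real"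
  assumes f: "f \<in> L2 \<Omega>" and g: "g \<in> borel_measurable (lebesgue_on \<Omega>)"
    and M: "\<And>x. x \<in> \<Omega> \<Longrightarrow> \<bar>g x\<bar> \<le> M"
  shows "(\<lambda>x. f x * g x) \<in> L2 \<Omega>"
proof -
  have [measurable]: "f \<in> borel_measurable (lebesgue_on \<Omega>)" using f by (simp add: L2_real_iff)
  note [measurable] = g
  have "integrable (lebesgue_on \<Omega>) (\<lambda>x. (f x * g x)\<^sup>2)"
  proof (rule Bochner_Integration.integrable_bound)
    show "integrable (lebesgue_on \<Omega>) (\<lambda>x. M\<^sup>2 * (f x)\<^sup>2)" using f by (simp add: L2_real_iff)
    show "(\<lambda>x. (f x * g x)\<^sup>2) \<in> borel_measurable (lebesgue_on \<Omega>)"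
      by measurable
    show "AE x in lebesgue_on \<Omega>. norm ((f x * g x)\<^sup>2) \<le> norm (M\<^sup>2 * (f x)\<^sup>2)"
    proof (rule AE_I2)
      fix x assume "x \<in> space (lebesgue_on \<Omega>)"
      then have "\<bar>g x\<bar>\<^sup>2 \<le> M\<^sup>2" using M by (intro power_mono) auto
      then show "norm ((f x * g x)\<^sup>2) \<le> norm (M\<^sup>2 * (f x)\<^sup>2)"
        by (simp add: power_mult_distrib mult.commute[of _ "(g x)\<^sup>2"] mult_right_mono)
    qed
  qed
  then show ?thesis by (simp add: L2_real_iff)
qed

lemma L2_const:
  assumes "\<Omega> \<in> lmeasurable"
  shows "(\<lambda>x. c::real) \<in> L2 \<Omega>"
  using finite_measure.integrable_const[OF finite_measure_lebesgue_on[OF assms]]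
  by (simp add: L2_real_iff)

lemma L2_bounded:
  fixes g :: "real^'d::finite \<Rightarrow> real"
  assumes "\<Omega> \<in> lmeasurable" and "g \<in> borel_measurable (lebesgue_on \<Omega>)" and "\<And>x. x \<in> \<Omega> \<Longrightarrow> \<bar>g x\<bar> \<le> M"
  shows "g \<in> L2 \<Omega>"
  using L2_mult_bounded[OF L2_const[OF assms(1), of 1] assms(2,3)] by simp

lemma L2_integrable:
  fixes f :: "real^'d::finite \<Rightarrow> real"
  assumes "\<Omega> \<in> lmeasurable" and "f \<in> L2 \<Omega>"
  shows "integrable (lebesgue_on \<Omega>) f"
  using L2_mult_integrable[OF assms(2) L2_const[OF assms(1), of 1]] by simp

lemma test_functions_L2:
  assumes "\<Omega> \<in> lmeasurable" and "\<phi> \<in> test_functions U"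
  shows "\<phi> \<in> L2 \<Omega>" and "partial j \<phi> \<in> L2 \<Omega>"
proof -
  have \<Omega>: "\<Omega> \<in> sets lebesgue" using assms(1) by auto
  obtain M where "\<And>x. \<bar>\<phi> x\<bar> \<le> M" using test_functions_bounded[OF assms(2)] by blast
  then show "\<phi> \<in> L2 \<Omega>"
    by (intro L2_bounded[OF assms(1)] continuous_imp_measurable_on_sets_lebesgue \<Omega>
        continuous_on_subset[OF test_functions_continuous[OF assms(2)]]) auto
  obtain M where "\<And>x. \<bar>partial j \<phi> x\<bar> \<le> M" using test_functions_partial_bounded[OF assms(2)] by blast
  then show "partial j \<phi> \<in> L2 \<Omega>"
    by (intro L2_bounded[OF assms(1)] continuous_imp_measurable_on_sets_lebesgue \<Omega>
        continuous_on_subset[OF test_functions_continuous_partial[OF assms(2)]]) auto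
qed

lemma L2_Cauchy_Schwarz:
  fixes f g :: "real^'d::finite \<Rightarrow> real"
  assumes f: "f \<in> L2 \<Omega>" and g: "g \<in> L2 \<Omega>"
  shows "\<bar>L2_inner \<Omega> f g\<bar> \<le> L2_norm \<Omega> f * L2_norm \<Omega> g"
proof -
  define A where "A = (LINT x|lebesgue_on \<Omega>. (f x)\<^sup>2)"
  define B where "B = (LINT x|lebesgue_on \<Omega>. f x * g x)"
  define C where "C = (LINT x|lebesgue_on \<Omega>. (g x)\<^sup>2)"
  have nonneg: "0 \<le> s\<^sup>2 * A + t\<^sup>2 * C - 2 * s * t * B" for s t
  proof -
    have "0 \<le> (LINT x|lebesgue_on \<Omega>. (s * f x - t * g x)\<^sup>2)" by simp
    also have "\<dots> = (LINT x|lebesgue_on \<Omega>. s\<^sup>2 * (f x)\<^sup>2 + t\<^sup>2 * (g x)\<^sup>2 - 2 * s * t * (f x * g x))"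
      by (simp add: power2_diff power_mult_distrib mult_ac)
    also have "\<dots> = s\<^sup>2 * A + t\<^sup>2 * C - 2 * s * t * B"
      using f g L2_mult_integrable[OF f g] by (simp add: A_def B_def C_def L2_real_iff)
    finally show ?thesis .
  qed
  have A: "0 \<le> A" and C: "0 \<le> C" by (simp_all add: A_def C_def)
  have "B\<^sup>2 \<le> A * C"
  proof (cases "C = 0")
    case False
    have "0 \<le> C * (A * C - B\<^sup>2)"
      \<comment> \<open>At \<open>s = C\<close>, \<open>t = B\<close> the quadratic form equals
        \<open>C * (A * C - B^2)\<close>.\<close>
      using nonneg[of C B] by (simp add: algebra_simps power2_eq_square)
    with False C show ?thesis by (simp add: zero_le_mult_iff)
  next
    case True
    have "B = 0"
    proof (rule ccontr)
      assume "B \<noteq> 0"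
      \<comment> \<open>With \<open>C = 0\<close> and \<open>s = 1\<close> the form is
        \<open>A - 2 * t * B\<close>, which is -1 at this \<open>t\<close>.\<close>
      with nonneg[of 1 "(A + 1) / (2 * B)"] True show False by (simp add: field_simps)
    qed
    then show ?thesis using True by simp
  qed
  then have "\<bar>B\<bar> \<le> sqrt A * sqrt C"
    using real_sqrt_le_mono by (fastforce simp: real_sqrt_mult[symmetric])
  then show ?thesis
    by (simp add: A_def B_def C_def L2_norm_def L2_inner_def power2_eq_square)
qed

lemma L2_inner_tendsto:
  fixes F b :: "real^'d::finite \<Rightarrow> real"
  assumes F: "F \<in> L2 \<Omega>" and b: "b \<in> L2 \<Omega>" and p: "\<And>n. p n \<in> L2 \<Omega>"
    and lim: "(\<lambda>n. L2_norm \<Omega> (\<lambda>x. b x - p n x)) \<longlonglongrightarrow> 0"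
  shows "(\<lambda>n. L2_inner \<Omega> F (p n)) \<longlonglongrightarrow> L2_inner \<Omega> F b"
proof -
  have "(\<lambda>n. L2_inner \<Omega> F b - L2_inner \<Omega> F (p n)) \<longlonglongrightarrow> 0"
  proof (rule Lim_null_comparison)
    show "(\<lambda>n. L2_norm \<Omega> F * L2_norm \<Omega> (\<lambda>x. b x - p n x)) \<longlonglongrightarrow> 0"
      by (rule tendsto_mult_right_zero[OF lim])
    have "L2_inner \<Omega> F b - L2_inner \<Omega> F (p n) = L2_inner \<Omega> F (\<lambda>x. b x - p n x)" for n
      using L2_mult_integrable[OF F b] L2_mult_integrable[OF F p]
      by (simp add: L2_inner_def right_diff_distrib)
    then show "\<forall>\<^sub>F n in sequentially. norm (L2_inner \<Omega> F b - L2_inner \<Omega> F (p n))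
        \<le> L2_norm \<Omega> F * L2_norm \<Omega> (\<lambda>x. b x - p n x)"
      using L2_Cauchy_Schwarz[OF F L2_diff[OF b p]] by simp
  qed
  from tendsto_diff[OF tendsto_const[of "L2_inner \<Omega> F b"] this] show ?thesis by simp
qed

text \<open>\<open>weak_partial\<close> is a choice; membership in \<open>H1\<close> makes the
  chosen condition satisfiable, and so the representative inherits it.\<close>

lemma H1_weak_partial:
  assumes "u \<in> H1 \<Omega>"
  shows "weak_partial \<Omega> j u \<in> L2 \<Omega>" and "has_weak_partial \<Omega> j u (weak_partial \<Omega> j u)"
proof -
  have "\<exists>g. g \<in> L2 \<Omega> \<and> has_weak_partial \<Omega> j u g" using assms by (auto simp: H1_def)
  from someI_ex[OF this]
  show "weak_partial \<Omega> j u \<in> L2 \<Omega>" and "has_weak_partial \<Omega> j u (weak_partial \<Omega> j u)"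
    by (auto simp: weak_partial_def)
qed

lemma affine_measurable_bounded:
  fixes L :: "real^'d::finite \<Rightarrow> real"
  assumes "bounded \<Omega>" and "\<Omega> \<in> sets lebesgue" and L: "bounded_linear L"
  shows "(\<lambda>x. L x + c) \<in> borel_measurable (lebesgue_on \<Omega>)"
    and "\<exists>M. \<forall>x\<in>\<Omega>. \<bar>L x + c\<bar> \<le> M"
proof -
  have cont: "continuous_on S (\<lambda>x. L x + c)" for S
    by (intro continuous_on_add linear_continuous_on[OF L] continuous_on_const)
  then show "(\<lambda>x. L x + c) \<in> borel_measurable (lebesgue_on \<Omega>)"
    by (rule continuous_imp_measurable_on_sets_lebesgue[OF _ assms(2)])
  have "compact ((\<lambda>x. L x + c) ` closure \<Omega>)"
    using assms(1) by (intro compact_continuous_image cont) simp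
  then obtain M where "\<forall>x\<in>closure \<Omega>. \<bar>L x + c\<bar> \<le> M"
    by (auto simp: bounded_iff dest!: compact_imp_bounded)
  then show "\<exists>M. \<forall>x\<in>\<Omega>. \<bar>L x + c\<bar> \<le> M" using closure_subset by blast
qed

text \<open>For \<open>b\<close> a test function the identity is the definition of the weak derivative of \<open>a\<close>,
  tested with \<open>b\<close> times the affine function; both sides are continuous in \<open>b\<close>.\<close>

lemma H10_integration_by_parts:
  fixes L :: "real^'d::finite \<Rightarrow> real"
  assumes bdd: "bounded \<Omega>" and \<Omega>: "\<Omega> \<in> lmeasurable" and L: "bounded_linear L"
    and a: "a \<in> H1 \<Omega>" and b: "b \<in> H10 \<Omega>"
  shows "integrable (lebesgue_on \<Omega>) (\<lambda>x. weak_partial \<Omega> j a x * b x * (L x + c))"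
    and "integrable (lebesgue_on \<Omega>) (\<lambda>x. a x * weak_partial \<Omega> j b x * (L x + c))"
    and "(LINT x|lebesgue_on \<Omega>. weak_partial \<Omega> j a x * b x * (L x + c))
      + (LINT x|lebesgue_on \<Omega>. a x * weak_partial \<Omega> j b x * (L x + c))
      + (LINT x|lebesgue_on \<Omega>. a x * b x) * L (axis j 1) = 0"
proof -
  let ?a' = "weak_partial \<Omega> j a" and ?b' = "weak_partial \<Omega> j b" and ?\<beta> = "L (axis j 1)"
  have \<Omega>s: "\<Omega> \<in> sets lebesgue" using \<Omega> by auto
  have b1: "b \<in> H1 \<Omega>" using b by (simp add: H10_def)
  have aL: "a \<in> L2 \<Omega>" and bL: "b \<in> L2 \<Omega>" using a b1 by (auto simp: H1_def)
  note a'L = H1_weak_partial(1)[OF a, of j] and b'L = H1_weak_partial(1)[OF b1, of j]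
  obtain M where M: "\<And>x. x \<in> \<Omega> \<Longrightarrow> \<bar>L x + c\<bar> \<le> M"
    using affine_measurable_bounded(2)[OF bdd \<Omega>s L] by blast
  note mult_g = L2_mult_bounded[OF _ affine_measurable_bounded(1)[OF bdd \<Omega>s L] M]
  \<comment> \<open>\<open>F\<close> collects what multiplies \<open>b\<close>, and \<open>G\<close>
    what multiplies its derivative: the claim becomes \<open>(F, b) + (G, b') = 0\<close>, and both
    coefficients are in \<open>L2\<close>.\<close>
  define F where "F x = ?a' x * (L x + c) + ?\<beta> * a x" for x
  define G where "G x = a x * (L x + c)" for x
  have F: "F \<in> L2 \<Omega>" unfolding F_def by (intro L2_add L2_scale mult_g a'L aL)
  have G: "G \<in> L2 \<Omega>" unfolding G_def by (intro mult_g aL)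
  show i1: "integrable (lebesgue_on \<Omega>) (\<lambda>x. ?a' x * b x * (L x + c))"
    using L2_mult_integrable[OF mult_g[OF a'L] bL] by (simp add: mult_ac)
  show i2: "integrable (lebesgue_on \<Omega>) (\<lambda>x. a x * ?b' x * (L x + c))"
    using L2_mult_integrable[OF mult_g[OF aL] b'L] by (simp add: mult_ac)
  obtain p where p: "\<And>n. p n \<in> test_functions \<Omega>"
    and p0: "(\<lambda>n. L2_norm \<Omega> (\<lambda>x. b x - p n x)) \<longlonglongrightarrow> 0"
    and p1: "(\<lambda>n. L2_norm \<Omega> (\<lambda>x. ?b' x - partial j (p n) x)) \<longlonglongrightarrow> 0"
    using b unfolding H10_def by blast
  have "L2_inner \<Omega> F (p n) + L2_inner \<Omega> G (partial j (p n)) = 0" for n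
  proof -
    note pL = test_functions_L2[OF \<Omega> p]
    have "L2_inner \<Omega> a (partial j (\<lambda>x. p n x * (L x + c))) = - L2_inner \<Omega> ?a' (\<lambda>x. p n x * (L x + c))"
      using H1_weak_partial(2)[OF a, of j] test_functions_mult_affine[OF p L, of n c]
      by (auto simp: has_weak_partial_def)
    moreover have "L2_inner \<Omega> a (partial j (\<lambda>x. p n x * (L x + c)))
        = L2_inner \<Omega> G (partial j (p n)) + (LINT x|lebesgue_on \<Omega>. ?\<beta> * a x * p n x)"
      unfolding L2_inner_def partial_mult_affine[OF p L]
      using L2_mult_integrable[OF G pL(2)[of j n]] L2_mult_integrable[OF L2_scale[OF aL, of ?\<beta>] pL(1)[of n]]
      by (subst Bochner_Integration.integral_add[symmetric]) (simp_all add: G_def algebra_simps)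
    moreover have "L2_inner \<Omega> ?a' (\<lambda>x. p n x * (L x + c)) + (LINT x|lebesgue_on \<Omega>. ?\<beta> * a x * p n x)
        = L2_inner \<Omega> F (p n)"
      unfolding L2_inner_def
      using L2_mult_integrable[OF mult_g[OF a'L] pL(1)[of n]] L2_mult_integrable[OF L2_scale[OF aL, of ?\<beta>] pL(1)[of n]]
      by (subst Bochner_Integration.integral_add[symmetric]) (simp_all add: F_def algebra_simps)
    ultimately show ?thesis by linarith
  qed
  moreover have "(\<lambda>n. L2_inner \<Omega> F (p n) + L2_inner \<Omega> G (partial j (p n)))
      \<longlonglongrightarrow> L2_inner \<Omega> F b + L2_inner \<Omega> G ?b'"
    by (intro tendsto_add L2_inner_tendsto F G bL b'L test_functions_L2[OF \<Omega> p] p0 p1)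
  ultimately have "L2_inner \<Omega> F b + L2_inner \<Omega> G ?b' = 0"
    by (simp add: LIMSEQ_const_iff)
  moreover have "L2_inner \<Omega> F b = (LINT x|lebesgue_on \<Omega>. ?a' x * b x * (L x + c)) + (LINT x|lebesgue_on \<Omega>. a x * b x) * ?\<beta>"
  proof -
    have "F x \<bullet> b x = ?a' x * b x * (L x + c) + a x * b x * ?\<beta>" for x
      by (simp add: F_def algebra_simps)
    then show ?thesis
      unfolding L2_inner_def using i1 L2_mult_integrable[OF aL bL] by simp
  qed
  moreover have "L2_inner \<Omega> G ?b' = (LINT x|lebesgue_on \<Omega>. a x * ?b' x * (L x + c))"
    by (simp add: L2_inner_def G_def mult_ac)
  ultimately show "(LINT x|lebesgue_on \<Omega>. ?a' x * b x * (L x + c))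
      + (LINT x|lebesgue_on \<Omega>. a x * ?b' x * (L x + c)) + (LINT x|lebesgue_on \<Omega>. a x * b x) * ?\<beta> = 0"
    by linarith
qed

text \<open>Against a test function supported in \<open>U\<close>, the function may be replaced by
  the affine one. The product rule and the vanishing integral of a partial derivative then move the
  derivative onto the affine function, and the fundamental lemma compares the two.\<close>

lemma weak_partial_AE_affine:
  fixes L :: "real^'d::finite \<Rightarrow> real"
  assumes bdd: "bounded \<Omega>" and \<Omega>: "\<Omega> \<in> lmeasurable" and U: "open U" "U \<subseteq> \<Omega>" and L: "bounded_linear L"
    and u: "u \<in> H1 \<Omega>" and u_eq: "AE x in lebesgue. x \<in> U \<longrightarrow> u x = L x + c"
  shows "AE x in lebesgue. x \<in> U \<longrightarrow> weak_partial \<Omega> j u x = L (axis j 1)"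
proof -
  let ?u' = "weak_partial \<Omega> j u" and ?\<beta> = "L (axis j 1)"
  have \<Omega>s: "\<Omega> \<in> sets lebesgue" using \<Omega> by auto
  have Us: "U \<in> sets lebesgue" using U(1) by (simp add: borel_open)
  have uL: "u \<in> L2 \<Omega>" using u by (simp add: H1_def)
  have u'L: "?u' \<in> L2 \<Omega>" by (rule H1_weak_partial(1)[OF u])
  have dL: "(\<lambda>x. ?u' x - ?\<beta>) \<in> L2 \<Omega>" by (intro L2_diff u'L L2_const \<Omega>)
  have "AE x in lebesgue. x \<in> U \<longrightarrow> ?u' x - ?\<beta> = 0"
  proof (rule orthogonal_test_functions_AE_0[OF _ U(1)])
    show "integrable (lebesgue_on U) (\<lambda>x. ?u' x - ?\<beta>)"
      by (rule integrable_lebesgue_on_subset[OF L2_integrable[OF \<Omega> dL] U(2) Us \<Omega>s])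
    fix \<phi> assume \<phi>: "\<phi> \<in> test_functions U"
    have \<phi>\<Omega>: "\<phi> \<in> test_functions \<Omega>" by (rule test_functions_mono[OF \<phi> U(2)])
    note \<phi>L = test_functions_L2[OF \<Omega> \<phi>]
    have aff: "(\<lambda>x. L x + c) \<in> borel_measurable (lebesgue_on \<Omega>)"
      by (rule affine_measurable_bounded(1)[OF bdd \<Omega>s L])
    obtain M where M: "\<And>x. x \<in> \<Omega> \<Longrightarrow> \<bar>L x + c\<bar> \<le> M"
      using affine_measurable_bounded(2)[OF bdd \<Omega>s L] by blast
    have int_g: "integrable (lebesgue_on \<Omega>) (\<lambda>x. partial j \<phi> x * (L x + c))"
      by (rule L2_integrable[OF \<Omega> L2_mult_bounded[OF \<phi>L(2) aff M]])
    have "- (LINT x|lebesgue_on \<Omega>. ?u' x * \<phi> x) = (LINT x|lebesgue_on \<Omega>. u x * partial j \<phi> x)"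
      using H1_weak_partial(2)[OF u, of j] \<phi>\<Omega> by (simp add: has_weak_partial_def L2_inner_def)
    also have "\<dots> = (LINT x|lebesgue_on \<Omega>. partial j \<phi> x * (L x + c))"
    proof (rule integral_cong_AE)
      show "(\<lambda>x. u x * partial j \<phi> x) \<in> borel_measurable (lebesgue_on \<Omega>)"
        using L2_mult_integrable[OF uL \<phi>L(2)] by blast
      show "(\<lambda>x. partial j \<phi> x * (L x + c)) \<in> borel_measurable (lebesgue_on \<Omega>)"
        using int_g by blast
      \<comment> \<open>Outside \<open>U\<close>, where nothing is known of \<open>u\<close>, the
        derivative of the test function is 0.\<close>
      have "AE x in lebesgue. x \<in> \<Omega> \<longrightarrow> u x * partial j \<phi> x = partial j \<phi> x * (L x + c)"
        using u_eq
      proof eventually_elim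
        case (elim x)
        then show ?case using test_functions_partial_eq_0[OF \<phi>, of x j] by (cases "x \<in> U") auto
      qed
      then show "AE x in lebesgue_on \<Omega>. u x * partial j \<phi> x = partial j \<phi> x * (L x + c)"
        by (simp add: AE_restrict_space_iff \<Omega>s)
    qed
    also have "\<dots> = (LINT x|lebesgue_on \<Omega>. partial j (\<lambda>x. \<phi> x * (L x + c)) x - ?\<beta> * \<phi> x)"
      by (simp add: partial_mult_affine[OF \<phi> L] mult.commute)
    also have "\<dots> = (LINT x|lebesgue_on \<Omega>. partial j (\<lambda>x. \<phi> x * (L x + c)) x) - (LINT x|lebesgue_on \<Omega>. ?\<beta> * \<phi> x)"
      by (intro Bochner_Integration.integral_diff L2_integrable[OF \<Omega>] L2_scale \<phi>L
          test_functions_L2(2)[OF \<Omega> test_functions_mult_affine[OF \<phi> L]])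
    also have "\<dots> = - (LINT x|lebesgue_on \<Omega>. ?\<beta> * \<phi> x)"
      using test_functions_integral_partial[OF test_functions_mult_affine[OF \<phi>\<Omega> L] \<Omega>s] by simp
    finally have "(LINT x|lebesgue_on \<Omega>. ?u' x * \<phi> x) - (LINT x|lebesgue_on \<Omega>. ?\<beta> * \<phi> x) = 0"
      by simp
    then have "(LINT x|lebesgue_on \<Omega>. (?u' x - ?\<beta>) * \<phi> x) = 0"
      using L2_mult_integrable[OF u'L \<phi>L(1)] L2_integrable[OF \<Omega> L2_scale[OF \<phi>L(1), of ?\<beta>]]
      by (simp add: left_diff_distrib)
    also have "(LINT x|lebesgue_on \<Omega>. (?u' x - ?\<beta>) * \<phi> x)
        = (LINT x|lebesgue_on \<Omega>. (if x \<in> U then (?u' x - ?\<beta>) * \<phi> x else 0))"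
      by (rule Bochner_Integration.integral_cong) (auto simp: test_functions_eq_0[OF \<phi>])
    also have "\<dots> = (LINT x|lebesgue_on U. (?u' x - ?\<beta>) * \<phi> x)"
      by (rule integral_restrict[OF U(2) Us \<Omega>s])
    finally show "(LINT x|lebesgue_on U. (?u' x - ?\<beta>) * \<phi> x) = 0" .
  qed
  then show ?thesis by simp
qed

section \<open>Rigid motions in the scheme\<close>

text \<open>Measurability is not assumed: Lebesgue measure is complete, so both functions are
  measurable or neither is, and in the second case both integrals are 0 by convention.\<close>

lemma integral_lebesgue_on_cong_AE:
  fixes f g :: "'a::euclidean_space \<Rightarrow> real"
  assumes S: "S \<in> sets lebesgue" and eq: "AE x in lebesgue. x \<in> S \<longrightarrow> f x = g x"
  shows "(LINT x|lebesgue_on S. f x) = (LINT x|lebesgue_on S. g x)"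
proof -
  define F where "F x = (if x \<in> S then f x else 0)" for x
  define G where "G x = (if x \<in> S then g x else 0)" for x
  have FG: "AE x in lebesgue. F x = G x"
    using eq by eventually_elim (simp add: F_def G_def)
  then have GF: "AE x in lebesgue. G x = F x" by eventually_elim simp
  have "(LINT x|lebesgue. F x) = (LINT x|lebesgue. G x)"
  proof (cases "F \<in> borel_measurable lebesgue")
    case True
    then show ?thesis by (intro integral_cong_AE FG borel_measurable_AE[OF _ FG])
  next
    case False
    then have "G \<notin> borel_measurable lebesgue" using borel_measurable_AE[OF _ GF] by blast
    with False show ?thesis
      by (metis not_integrable_integral_eq borel_measurable_integrable)
  qed
  then show ?thesis
    by (simp add: F_def[abs_def] G_def[abs_def] Lebesgue_Measure.integral_restrict_UNIV[OF S])
qed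

text \<open>The disjunction fits the strip: there the first factor vanishes, and elsewhere the
  second factors agree.\<close>

lemma L2_inner_cong_AE:
  fixes F G H :: "real^'d::finite \<Rightarrow> 'b::euclidean_space"
  assumes "\<Omega> \<in> sets lebesgue" and "AE x in lebesgue. x \<in> \<Omega> \<longrightarrow> F x = 0 \<or> G x = H x"
  shows "L2_inner \<Omega> F G = L2_inner \<Omega> F H"
  unfolding L2_inner_def
  by (rule integral_lebesgue_on_cong_AE[OF assms(1)]) (use assms(2) in \<open>eventually_elim; auto\<close>)

lemma skew_matrix_nth:
  fixes B :: "real^'d^'d"
  assumes "transpose B = - B"
  shows "B $ j $ i = - B $ i $ j"
proof -
  have "B $ j $ i = transpose B $ i $ j" by (simp add: transpose_def)
  also have "\<dots> = - B $ i $ j" by (simp add: assms)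
  finally show ?thesis .
qed

text \<open>Write \<open>g = B x + c\<close>. The terms \<open>(\<partial>_i w_j) w_j g_i\<close>
  are half the derivative of \<open>w_j^2\<close> and integrate to a multiple of
  \<open>B_ii = 0\<close>. The remaining terms combine to \<open>\<partial>_j (w_i w_j) g_i\<close>,
  which integrates to \<open>- w_i w_j B_ij\<close>; summed, a symmetric matrix meets a skew
  one.\<close>

lemma emac_skew_affine_eq_0:
  fixes w :: "real^'d::finite \<Rightarrow> real^'d" and B :: "real^'d^'d"
  assumes bdd: "bounded \<Omega>" and \<Omega>: "\<Omega> \<in> lmeasurable" and w: "w \<in> H10_vec \<Omega>"
    and skew: "transpose B = - B"
  shows "emac \<Omega> w w (\<lambda>x. B *v x + c) = 0"
proof -
  have w10: "(\<lambda>x. w x $ i) \<in> H10 \<Omega>" and w1: "(\<lambda>x. w x $ i) \<in> H1 \<Omega>" for i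
    using w by (auto simp: H10_vec_def H10_def)
  note skew' = skew_matrix_nth[OF skew]
  define W where "W i j = weak_partial \<Omega> j (\<lambda>x. w x $ i)" for i j
  define g where "g i x = (B *v x) $ i + c $ i" for i x
  define I where "I i j k = (LINT x|lebesgue_on \<Omega>. W i j x * w x $ k * g i x)" for i j k
  define m where "m i j = (LINT x|lebesgue_on \<Omega>. w x $ i * w x $ j)" for i j
  have L: "bounded_linear (\<lambda>x. (B *v x) $ i)" for i
    by (rule bounded_linear_compose[OF bounded_linear_vec_nth matrix_vector_mul_bounded_linear])
  have BL: "(B *v axis j 1) $ i = B $ i $ j" for i j
    by (simp add: matrix_vector_mult_basis column_def)
  note ibp = H10_integration_by_parts[OF bdd \<Omega> L w1 w10, where c="c $ _"]
  have int1: "integrable (lebesgue_on \<Omega>) (\<lambda>x. W i j x * w x $ k * g l x)" for i j k l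
    using ibp(1)[of j i k l l] by (simp add: W_def g_def)
  have int2: "integrable (lebesgue_on \<Omega>) (\<lambda>x. w x $ k * W i j x * g l x)" for i j k l
    using ibp(2)[of k j i l l] by (simp add: W_def g_def)
  \<comment> \<open>Integration by parts of \<open>w_i\<close> against \<open>w_j\<close> in
    direction \<open>j\<close>; the second integral is a term of the divergence part.\<close>
  have ibp1: "(LINT x|lebesgue_on \<Omega>. W i j x * w x $ j * g i x)
      + (LINT x|lebesgue_on \<Omega>. w x $ i * W j j x * g i x) + m i j * B $ i $ j = 0" for i j
    using ibp(3)[of j i j i i] by (simp add: W_def g_def m_def BL)
  \<comment> \<open>Both factors are \<open>w_j\<close> here, so the two integrals coincide, and the
    boundaryless remainder carries \<open>B_ii = 0\<close>.\<close>
  have ibp2: "(LINT x|lebesgue_on \<Omega>. W j i x * w x $ j * g i x) = 0" for i j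
  proof -
    have "B $ i $ i = 0" using skew'[of i i] by simp
    moreover have "(LINT x|lebesgue_on \<Omega>. w x $ j * W j i x * g i x) = (LINT x|lebesgue_on \<Omega>. W j i x * w x $ j * g i x)"
      by (simp add: mult.commute[of "w _ $ j"])
    ultimately show ?thesis
      using ibp(3)[of i j j i i] by (simp add: W_def g_def BL)
  qed
  have "2 * L2_inner \<Omega> (\<lambda>x. sym_grad \<Omega> w x *v w x) (\<lambda>x. B *v x + c)
      = 2 * (LINT x|lebesgue_on \<Omega>. (\<Sum>i\<in>UNIV. \<Sum>j\<in>UNIV. 1/2 * (W i j x * w x $ j * g i x + W j i x * w x $ j * g i x)))"
  proof -
    have "(sym_grad \<Omega> w x *v w x) $ i = (\<Sum>j\<in>UNIV. 1/2 * (W i j x + W j i x) * w x $ j)" for x i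
      by (simp add: sym_grad_def wgrad_def matrix_vector_mult_def transpose_def W_def)
    then have "(sym_grad \<Omega> w x *v w x) \<bullet> (B *v x + c)
        = (\<Sum>i\<in>UNIV. \<Sum>j\<in>UNIV. 1/2 * (W i j x + W j i x) * w x $ j * g i x)" for x
      by (simp add: inner_vec_def g_def sum_distrib_right)
    then show ?thesis by (simp add: L2_inner_def distrib_right)
  qed
  also have "\<dots> = (\<Sum>i\<in>UNIV. \<Sum>j\<in>UNIV. (LINT x|lebesgue_on \<Omega>. W i j x * w x $ j * g i x))"
    using int1 by (simp add: sum_distrib_left ibp2)
  finally have 1: "2 * L2_inner \<Omega> (\<lambda>x. sym_grad \<Omega> w x *v w x) (\<lambda>x. B *v x + c)
      = (\<Sum>i\<in>UNIV. \<Sum>j\<in>UNIV. (LINT x|lebesgue_on \<Omega>. W i j x * w x $ j * g i x))" .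
  have "L2_inner \<Omega> (\<lambda>x. wdiv \<Omega> w x *\<^sub>R w x) (\<lambda>x. B *v x + c)
      = (LINT x|lebesgue_on \<Omega>. (\<Sum>i\<in>UNIV. \<Sum>j\<in>UNIV. w x $ i * W j j x * g i x))"
  proof -
    have "(wdiv \<Omega> w x *\<^sub>R w x) \<bullet> (B *v x + c)
        = (\<Sum>i\<in>UNIV. w x $ i * (\<Sum>j\<in>UNIV. W j j x) * g i x)" for x
      by (simp add: inner_vec_def wdiv_def trace_def wgrad_def W_def g_def mult.commute[of _ "w x $ _"])
    then show ?thesis
      unfolding L2_inner_def by (simp only: sum_distrib_left sum_distrib_right)
  qed
  also have "\<dots> = (\<Sum>i\<in>UNIV. \<Sum>j\<in>UNIV. (LINT x|lebesgue_on \<Omega>. w x $ i * W j j x * g i x))"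
    using int2 by simp
  finally have 2: "L2_inner \<Omega> (\<lambda>x. wdiv \<Omega> w x *\<^sub>R w x) (\<lambda>x. B *v x + c)
      = (\<Sum>i\<in>UNIV. \<Sum>j\<in>UNIV. (LINT x|lebesgue_on \<Omega>. w x $ i * W j j x * g i x))" .
  have "emac \<Omega> w w (\<lambda>x. B *v x + c) = (\<Sum>i\<in>UNIV. \<Sum>j\<in>UNIV. - (m i j * B $ i $ j))"
    unfolding emac_def 1 2 sum.distrib[symmetric]
    by (intro sum.cong refl) (use ibp1 in \<open>simp add: eq_neg_iff_add_eq_0\<close>)
  \<comment> \<open>Exchanging the indices turns the sum into its own negative.\<close>
  moreover have "(\<Sum>i\<in>UNIV. \<Sum>j\<in>UNIV. m i j * B $ i $ j) = - (\<Sum>i\<in>UNIV. \<Sum>j\<in>UNIV. m i j * B $ i $ j)"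
  proof -
    have "(\<Sum>i\<in>UNIV. \<Sum>j\<in>UNIV. m i j * B $ i $ j) = (\<Sum>j\<in>UNIV. \<Sum>i\<in>UNIV. m i j * B $ i $ j)"
      by (rule sum.swap)
    also have "\<dots> = (\<Sum>j\<in>UNIV. \<Sum>i\<in>UNIV. - (m j i * B $ j $ i))"
    proof (intro sum.cong refl)
      fix i j
      have "m i j = m j i" by (simp add: m_def mult.commute)
      moreover have "B $ i $ j = - B $ j $ i" by (rule skew')
      ultimately show "m i j * B $ i $ j = - (m j i * B $ j $ i)" by simp
    qed
    finally show ?thesis by (simp add: sum_negf)
  qed
  ultimately show ?thesis by (simp add: sum_negf)
qed

text \<open>A skew matrix has zero diagonal, so each summand of the divergence already vanishes
  almost everywhere on \<open>U\<close>.\<close>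

lemma AE_wdiv_skew_affine_eq_0:
  fixes v :: "real^'d::finite \<Rightarrow> real^'d" and B :: "real^'d^'d"
  assumes bdd: "bounded \<Omega>" and \<Omega>: "\<Omega> \<in> lmeasurable" and v: "v \<in> H10_vec \<Omega>"
    and skew: "transpose B = - B" and U: "open U" "U \<subseteq> \<Omega>"
    and eq: "AE x in lebesgue. x \<in> U \<longrightarrow> v x = B *v x + c"
  shows "AE x in lebesgue. x \<in> U \<longrightarrow> wdiv \<Omega> v x = 0"
proof -
  have "AE x in lebesgue. x \<in> U \<longrightarrow> weak_partial \<Omega> i (\<lambda>y. v y $ i) x = 0" for i
  proof -
    have L: "bounded_linear (\<lambda>x. (B *v x) $ i)"
      by (rule bounded_linear_compose[OF bounded_linear_vec_nth matrix_vector_mul_bounded_linear])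
    have "AE x in lebesgue. x \<in> U \<longrightarrow> v x $ i = (B *v x) $ i + c $ i"
      using eq by eventually_elim simp
    moreover have "(\<lambda>x. v x $ i) \<in> H1 \<Omega>" using v by (simp add: H10_vec_def H10_def)
    ultimately have "AE x in lebesgue. x \<in> U \<longrightarrow> weak_partial \<Omega> i (\<lambda>y. v y $ i) x = (B *v axis i 1) $ i"
      using weak_partial_AE_affine[OF bdd \<Omega> U L] by blast
    moreover have "B $ i $ i = - B $ i $ i" by (rule skew_matrix_nth[OF skew])
    ultimately show ?thesis by (simp add: matrix_vector_mult_basis column_def)
  qed
  then have "AE x in lebesgue. \<forall>i\<in>UNIV. x \<in> U \<longrightarrow> weak_partial \<Omega> i (\<lambda>y. v y $ i) x = 0"
    by (subst AE_ball_countable) auto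
  then show ?thesis by eventually_elim (simp add: wdiv_def trace_def wgrad_def)
qed

text \<open>In the interior of an element the nonzero set is the preimage of an open set under a
  polynomial. What is lost are the frontiers of finitely many convex elements, a null set. The open
  set is what permits localising weak derivatives.\<close>

lemma fe_space_support:
  fixes q :: "real^'d::finite \<Rightarrow> real"
  assumes \<Omega>: "open \<Omega>" "convex \<Omega>" and mesh: "regular_mesh \<Omega> \<T> \<sigma> h"
    and V: "fe_space \<T> V" and q: "q \<in> V"
  shows "\<exists>U. open U \<and> U \<subseteq> \<Omega> \<and> (\<forall>x\<in>U. q x \<noteq> 0) \<and>
    (AE x in lebesgue. x \<in> \<Omega> - U \<longrightarrow> q x = 0)"
proof -
  have T: "finite \<T>" "\<And>K. K \<in> \<T> \<Longrightarrow> convex K" "\<Union>\<T> = closure \<Omega>"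
    using mesh by (auto simp: regular_mesh_def triangulation_def intro: convex_simplex)
  define U where "U = (\<Union>K\<in>\<T>. {x \<in> interior K. q x \<noteq> 0})"
  have "open {x \<in> interior K. q x \<noteq> 0}" if K: "K \<in> \<T>" for K
  proof -
    have "\<forall>v\<in>V. \<forall>K\<in>\<T>. \<exists>p. polynomial_function p \<and> (\<forall>x\<in>interior K. v x = p x)"
      using V unfolding fe_space_def by (rule conjunct2)
    from bspec[OF bspec[OF this q] K] obtain p
      where p: "polynomial_function p" "\<forall>x\<in>interior K. q x = p x" by auto
    have "open (interior K \<inter> p -` (- {0}))"
      by (rule continuous_open_preimage[OF continuous_on_polymonial_function[OF p(1)]]) auto
    also have "interior K \<inter> p -` (- {0}) = {x \<in> interior K. q x \<noteq> 0}"
      using p(2) by auto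
    finally show ?thesis .
  qed
  then have "open U" by (auto simp: U_def)
  moreover have "U \<subseteq> \<Omega>"
  proof -
    \<comment> \<open>Elements lie in the closure of \<open>\<Omega>\<close>; an open convex set is
      the interior of its closure.\<close>
    have "interior K \<subseteq> \<Omega>" if "K \<in> \<T>" for K
      using interior_mono[of K "closure \<Omega>"] that T(3) convex_interior_closure[OF \<Omega>(2)] interior_open[OF \<Omega>(1)]
      by auto
    then show ?thesis by (auto simp: U_def)
  qed
  moreover have "AE x in lebesgue. x \<in> \<Omega> - U \<longrightarrow> q x = 0"
  proof -
    have "negligible (\<Union>(frontier ` \<T>))"
      using T by (intro negligible_Union) (auto intro: negligible_convex_frontier)
    moreover have "{x. \<not> (x \<in> \<Omega> - U \<longrightarrow> q x = 0)} \<subseteq> \<Union>(frontier ` \<T>)"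
    proof
      fix x assume "x \<in> {x. \<not> (x \<in> \<Omega> - U \<longrightarrow> q x = 0)}"
      then have x: "x \<in> \<Omega>" "x \<notin> U" "q x \<noteq> 0" by auto
      then obtain K where "K \<in> \<T>" "x \<in> K" using T(3) closure_subset[of \<Omega>] by blast
      with x show "x \<in> \<Union>(frontier ` \<T>)" using closure_subset[of K] by (auto simp: U_def frontier_def)
    qed
    ultimately show ?thesis
      by (intro AE_I'[of "\<Union>(frontier ` \<T>)"]) (auto simp: negligible_iff_null_sets)
  qed
  moreover have "\<forall>x\<in>U. q x \<noteq> 0" by (auto simp: U_def)
  ultimately show ?thesis by blast
qed

lemma fe_space_linear:
  assumes "fe_space \<T> V" and "u \<in> V" "v \<in> V"
  shows "(\<lambda>x. a *\<^sub>R u x + b *\<^sub>R v x) \<in> V"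
proof -
  obtain S where S: "V = range (\<lambda>(c::(real^'a \<Rightarrow> 'b) \<Rightarrow> real) x. \<Sum>\<beta>\<in>S. c \<beta> *\<^sub>R \<beta> x)"
    using assms(1) unfolding fe_space_def by blast
  obtain c d where "u = (\<lambda>x. \<Sum>\<beta>\<in>S. c \<beta> *\<^sub>R \<beta> x)" "v = (\<lambda>x. \<Sum>\<beta>\<in>S. d \<beta> *\<^sub>R \<beta> x)"
    using assms(2,3) unfolding S by blast
  then have "(\<lambda>x. a *\<^sub>R u x + b *\<^sub>R v x) = (\<lambda>x. \<Sum>\<beta>\<in>S. (a * c \<beta> + b * d \<beta>) *\<^sub>R \<beta> x)"
    by (simp add: fun_eq_iff scaleR_left_distrib sum.distrib scaleR_sum_right)
  then show ?thesis unfolding S by (intro image_eqI[of _ _ "\<lambda>\<beta>. a * c \<beta> + b * d \<beta>"]) auto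
qed

section \<open>Cross products under the embedding\<close>

lemma embed3_nth: "inj \<iota> \<Longrightarrow> embed3 \<iota> x $ \<iota> a = x $ a"
  by (simp add: embed3_def axis_def inj_eq if_distrib if_distribR cong: if_cong)

lemma embed3_nth_notin: "k \<notin> range \<iota> \<Longrightarrow> embed3 \<iota> x $ k = 0"
  by (auto simp: embed3_def axis_def intro!: sum.neutral)

text \<open>Vectors orthogonal to the \<open>k\<close>-th axis have a cross product parallel to
  it.\<close>

lemma cross3_axis_coplanar:
  "p \<noteq> k \<Longrightarrow> q \<noteq> k \<Longrightarrow> i \<noteq> k \<Longrightarrow> cross3 (axis p 1) (axis q 1) $ i = 0"
proof -
  have "\<forall>p q i k. p \<noteq> k \<longrightarrow> q \<noteq> k \<longrightarrow> i \<noteq> k \<longrightarrow> cross3 (axis p 1) (axis q 1) $ i = 0"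
    unfolding forall_3 by (simp add: cross_components axis_def)
  then show "p \<noteq> k \<Longrightarrow> q \<noteq> k \<Longrightarrow> i \<noteq> k \<Longrightarrow> cross3 (axis p 1) (axis q 1) $ i = 0" by blast
qed

text \<open>By bilinearity each component is a bilinear form; this writes angular momentum as a
  pairing of the velocity with a linear field.\<close>

lemma cross3_embed3_nth:
  "cross3 (embed3 \<iota> v) (embed3 \<iota> x) $ i
    = v \<bullet> ((\<chi> a b. cross3 (axis (\<iota> a) 1) (axis (\<iota> b) 1) $ i) *v x)"
proof -
  have "cross3 (embed3 \<iota> v) (embed3 \<iota> x)
      = (\<Sum>(a, b)\<in>UNIV \<times> UNIV. cross3 (v $ a *\<^sub>R axis (\<iota> a) 1) (x $ b *\<^sub>R axis (\<iota> b) 1))"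
    unfolding embed3_def by (rule bilinear_sum[OF bilinear_cross])
  also have "\<dots> = (\<Sum>a\<in>UNIV. \<Sum>b\<in>UNIV. (v $ a * x $ b) *\<^sub>R cross3 (axis (\<iota> a) 1) (axis (\<iota> b) 1))"
    by (simp add: sum.cartesian_product cross_mult_left cross_mult_right mult.commute)
  finally show ?thesis
    by (simp add: inner_vec_def matrix_vector_mult_def sum_distrib_left mult_ac)
qed

text \<open>If an axis other than \<open>i\<close> is missing from the embedded space, all cross
  products there are multiples of that axis, and their \<open>i\<close>-th component is zero.
  Otherwise only the axis \<open>i\<close> can be missing, and the field of cross products with this
  axis, being orthogonal to it, stays in the embedded space.\<close>

lemma rotation_matrix_cases:
  fixes \<iota> :: "'d::finite \<Rightarrow> 3" and i :: 3
  defines "B \<equiv> (\<chi> a b. cross3 (axis (\<iota> a) 1) (axis (\<iota> b) 1) $ i) :: real^'d^'d"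
  assumes \<iota>: "inj \<iota>"
  shows "B = 0 \<or> is_rotation_field \<iota> i (\<lambda>x. B *v x)"
proof (cases "\<exists>k. k \<notin> range \<iota> \<and> k \<noteq> i")
  case True
  then obtain k where "k \<notin> range \<iota>" "k \<noteq> i" by blast
  then have "cross3 (axis (\<iota> a) 1) (axis (\<iota> b) 1) $ i = 0" for a b
    by (intro cross3_axis_coplanar[of _ k]) auto
  then show ?thesis by (simp add: B_def vec_eq_iff)
next
  case False
  have "embed3 \<iota> (B *v x) $ k = cross3 (embed3 \<iota> x) (axis i 1) $ k" for x k
  proof (cases "k \<in> range \<iota>")
    case True
    then obtain a where k: "k = \<iota> a" by blast
    have "(B *v x) $ a = axis a 1 \<bullet> (B *v x)" by (simp add: inner_axis')
    also have "\<dots> = cross3 (embed3 \<iota> (axis a 1)) (embed3 \<iota> x) $ i"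
      unfolding B_def cross3_embed3_nth ..
    also have "embed3 \<iota> (axis a 1) = axis k 1"
      by (simp add: embed3_def k axis_def vec_eq_iff if_distrib if_distribR cong: if_cong)
    also have "cross3 (axis k 1) (embed3 \<iota> x) $ i = cross3 (axis k 1) (embed3 \<iota> x) \<bullet> axis i 1"
      by (simp add: inner_axis)
    \<comment> \<open>Cyclic invariance of the triple product.\<close>
    also have "\<dots> = cross3 (embed3 \<iota> x) (axis i 1) \<bullet> axis k 1"
      by (rule cross_triple)
    finally show ?thesis by (simp add: k embed3_nth[OF \<iota>] inner_axis)
  next
    case False
    with \<open>\<not> (\<exists>k. k \<notin> range \<iota> \<and> k \<noteq> i)\<close> have "k = i" by blast
    have "cross3 (embed3 \<iota> x) (axis i 1) $ k = cross3 (embed3 \<iota> x) (axis i 1) \<bullet> axis i 1"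
      by (simp add: inner_axis \<open>k = i\<close>)
    then show ?thesis using False by (simp add: embed3_nth_notin dot_cross_self)
  qed
  then show ?thesis by (simp add: is_rotation_field_def vec_eq_iff)
qed

text \<open>The characteristic polynomial is \<open>(z - 1) (3 z - 1) / 2\<close>; equal starting
  values exclude the mode with root 1/3.\<close>

lemma two_step_recursion_const:
  fixes m :: "int \<Rightarrow> real"
  assumes "\<And>n. n \<in> {0..int N - 1} \<Longrightarrow> 3/2 * m (n + 1) - 2 * m n + 1/2 * m (n - 1) = 0"
    and "m (-1) = m 0" and "n \<in> {0..int N}"
  shows "m n = m 0"
proof -
  \<comment> \<open>The induction carries two consecutive values; at \<open>k = 0\<close> the
    predecessor is the level -1.\<close>
  have "k \<le> N \<longrightarrow> m (int k) = m 0 \<and> m (int k - 1) = m 0" for k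
  proof (induction k)
    case (Suc k)
    show ?case
    proof
      assume k: "Suc k \<le> N"
      with Suc have "m (int k) = m 0" "m (int k - 1) = m 0" by auto
      moreover from k have "3/2 * m (int k + 1) - 2 * m (int k) + 1/2 * m (int k - 1) = 0"
        by (intro assms(1)) auto
      ultimately show "m (int (Suc k)) = m 0 \<and> m (int (Suc k) - 1) = m 0"
        by (simp add: add.commute)
    qed
  qed (use assms(2) in simp)
  from this[of "nat n"] assms(3) show ?thesis by auto
qed

section \<open>Conservation along the scheme\<close>

lemma convex_polytopal_domain_bounded:
  assumes "convex_polytopal_domain \<Omega>"
  shows "bounded \<Omega>"
proof (rule bounded_subset[OF _ closure_subset])
  show "bounded (closure \<Omega>)"
    using assms by (simp add: convex_polytopal_domain_def polytope_imp_bounded)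
qed

lemma H10_vec_L2: "v \<in> H10_vec \<Omega> \<Longrightarrow> (\<lambda>x. v x $ i) \<in> L2 \<Omega>"
  by (simp add: H10_vec_def H10_def H1_def)

lemma H10_vec_inner_integrable:
  assumes "v \<in> H10_vec \<Omega>" and "\<And>i. (\<lambda>x. w x $ i) \<in> L2 \<Omega>"
  shows "integrable (lebesgue_on \<Omega>) (\<lambda>x. v x \<bullet> w x)"
  unfolding inner_vec_def
  by (intro Bochner_Integration.integrable_sum) (simp add: L2_mult_integrable[OF H10_vec_L2[OF assms(1)] assms(2)])

text \<open>One statement serves both quantities: \<open>B = 0\<close> and \<open>c = e_i\<close>
  give momentum, while \<open>c = 0\<close> and the cross product matrix give angular
  momentum.\<close>

lemma emac_scheme_conserves_skew_affine:
  fixes \<Omega> \<Omega>s \<Omega>i :: "(real^'d::finite) set" and B :: "real^'d^'d"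
  assumes domain: "convex_polytopal_domain \<Omega>" and mesh: "regular_mesh \<Omega> \<T> \<sigma> h"
    and Xh: "velocity_space \<Omega> \<T> Xh" and Qh: "pressure_space \<Omega> \<T> Qh"
    and dt: "\<Delta>t \<noteq> 0" and init: "u 0 \<in> Xh" "u (-1) = u 0"
    and f: "\<And>t x. f t x = 0"
    and scheme: "emac_filtered_solution \<Omega> Xh Qh 0 f \<Delta>t N u P"
    and strip: "\<Omega> = \<Omega>s \<union> \<Omega>i"
    and u_strip: "\<And>n. n \<in> {-1..int N} \<Longrightarrow> vanishes_on \<Omega>s (u n)"
    and P_strip: "\<And>n. n \<in> {1..int N} \<Longrightarrow> vanishes_on \<Omega>s (P n)"
    and skew: "transpose B = - B" and cutoff: "cutoff_available Xh \<Omega>i (\<lambda>x. B *v x + c)"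
    and n: "n \<in> {0..int N}"
  shows "L2_inner \<Omega> (u n) (\<lambda>x. B *v x + c) = L2_inner \<Omega> (u 0) (\<lambda>x. B *v x + c)"
proof -
  have \<Omega>: "open \<Omega>" "convex \<Omega>" and bdd: "bounded \<Omega>"
    using domain convex_polytopal_domain_bounded[OF domain]
    by (simp_all add: convex_polytopal_domain_def)
  have \<Omega>m: "\<Omega> \<in> lmeasurable" using \<Omega>(1) bdd by (rule lmeasurable_open[rotated])
  then have \<Omega>s: "\<Omega> \<in> sets lebesgue" by auto
  have fe: "fe_space \<T> Xh" and X10: "\<And>v. v \<in> Xh \<Longrightarrow> v \<in> H10_vec \<Omega>"
    using Xh by (auto simp: velocity_space_def)
  obtain z where z: "z \<in> Xh" and z_eq: "AE x in lebesgue. x \<in> \<Omega>i \<longrightarrow> z x = B *v x + c"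
    using cutoff by (auto simp: cutoff_available_def)
  have uX: "u k \<in> Xh" if k: "k \<in> {-1..int N}" for k
  proof (cases "k \<ge> 1")
    case True
    with k have "k - 1 \<in> {0..int N - 1}" by auto
    from bspec[OF scheme[unfolded emac_filtered_solution_def] this]
    have "u (k - 1 + 1) \<in> Xh" by (elim conjE)
    then show ?thesis by simp
  next
    case False
    with k have "k = -1 \<or> k = 0" by auto
    then show ?thesis using init by auto
  qed
  \<comment> \<open>No measurability of \<open>F\<close> is required, so this applies directly to
    the nonlinear terms.\<close>
  have replace: "L2_inner \<Omega> F z = L2_inner \<Omega> F (\<lambda>x. B *v x + c)"
    if "AE x in lebesgue. x \<in> \<Omega>s \<longrightarrow> F x = 0" for F :: "real^'d \<Rightarrow> real^'d"
    by (rule L2_inner_cong_AE[OF \<Omega>s]) (use that z_eq in \<open>eventually_elim; use strip in auto\<close>)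
  define m where "m k = L2_inner \<Omega> (u k) z" for k
  have int_m: "integrable (lebesgue_on \<Omega>) (\<lambda>x. u k x \<bullet> z x)" if "k \<in> {-1..int N}" for k
    by (rule H10_vec_inner_integrable[OF X10[OF uX[OF that]] H10_vec_L2[OF X10[OF z]]])
  have step: "3/2 * m (k + 1) - 2 * m k + 1/2 * m (k - 1) = 0" if k: "k \<in> {0..int N - 1}" for k
  proof -
    define w where "w = time_filter u (k + 1)"
    \<comment> \<open>Nested two-term combinations, the form in which linearity of the finite
      element space is stated.\<close>
    have w_eq: "w = (\<lambda>x. 1 *\<^sub>R ((3/2) *\<^sub>R u (k + 1) x + (-1) *\<^sub>R u k x) + (1/2) *\<^sub>R u (k - 1) x)"
      by (simp add: w_def time_filter_def fun_eq_iff)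
    have wX: "w \<in> Xh"
      unfolding w_eq by (intro fe_space_linear[OF fe] uX) (use k in auto)
    have "vanishes_on \<Omega>s (u (k + 1))" "vanishes_on \<Omega>s (u k)" "vanishes_on \<Omega>s (u (k - 1))"
      using k by (auto intro!: u_strip)
    then have w0: "AE x in lebesgue. x \<in> \<Omega>s \<longrightarrow> w x = 0"
      unfolding vanishes_on_def by eventually_elim (simp add: w_eq)
    have "emac \<Omega> w w z = emac \<Omega> w w (\<lambda>x. B *v x + c)"
    proof -
      \<comment> \<open>The undifferentiated factor \<open>w\<close> suffices; nothing is claimed
        about weak derivatives on the strip.\<close>
      have "AE x in lebesgue. x \<in> \<Omega>s \<longrightarrow> sym_grad \<Omega> w x *v w x = 0"
        using w0 by eventually_elim simp
      moreover have "AE x in lebesgue. x \<in> \<Omega>s \<longrightarrow> wdiv \<Omega> w x *\<^sub>R w x = 0"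
        using w0 by eventually_elim simp
      ultimately show ?thesis by (simp add: emac_def replace)
    qed
    then have emac0: "emac \<Omega> w w z = 0"
      using emac_skew_affine_eq_0[OF bdd \<Omega>m X10[OF wX] skew] by simp
    note scheme_k = bspec[OF scheme[unfolded emac_filtered_solution_def] k]
    have PQ: "P (k + 1) \<in> Qh" using scheme_k by (elim conjE)
    have pressure0: "L2_inner \<Omega> (P (k + 1)) (wdiv \<Omega> z) = 0"
    proof -
      have feQ: "fe_space \<T> Qh" using Qh by (simp add: pressure_space_def)
      obtain U where U: "open U" "U \<subseteq> \<Omega>" and PU: "\<forall>x\<in>U. P (k + 1) x \<noteq> 0"
        and PU': "AE x in lebesgue. x \<in> \<Omega> - U \<longrightarrow> P (k + 1) x = 0"
        using fe_space_support[OF \<Omega> mesh feQ PQ] by blast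
      have "vanishes_on \<Omega>s (P (k + 1))" using k by (intro P_strip) auto
      \<comment> \<open>Up to a null set a point with nonzero pressure is not in the strip, hence in
        \<open>\<Omega>i\<close>, where the cutoff is the rigid motion.\<close>
      then have "AE x in lebesgue. x \<in> U \<longrightarrow> z x = B *v x + c"
        unfolding vanishes_on_def using z_eq
        by eventually_elim (use PU U(2) strip in blast)
      from AE_wdiv_skew_affine_eq_0[OF bdd \<Omega>m X10[OF z] skew U this]
      have "AE x in lebesgue. x \<in> \<Omega> \<longrightarrow> P (k + 1) x \<bullet> wdiv \<Omega> z x = 0"
        using PU' by eventually_elim auto
      then show ?thesis
        unfolding L2_inner_def by (intro integral_eq_zero_AE) (simp add: AE_restrict_space_iff \<Omega>s)
    qed
    have "1 / \<Delta>t * L2_inner \<Omega> (\<lambda>x. (3/2) *\<^sub>R u (k + 1) x - 2 *\<^sub>R u k x + (1/2) *\<^sub>R u (k - 1) x) z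
        + 0 * L2_inner \<Omega> (wgrad \<Omega> w) (wgrad \<Omega> z) + emac \<Omega> w w z - L2_inner \<Omega> (P (k + 1)) (wdiv \<Omega> z)
        = L2_inner \<Omega> (f (real_of_int (k + 1) * \<Delta>t)) z"
      unfolding w_def using bspec[OF conjunct1[OF conjunct2[OF conjunct2[OF scheme_k]]] z] .
    moreover have "L2_inner \<Omega> (f t) z = 0" for t by (simp add: L2_inner_def f)
    ultimately have "L2_inner \<Omega> (\<lambda>x. (3/2) *\<^sub>R u (k + 1) x - 2 *\<^sub>R u k x + (1/2) *\<^sub>R u (k - 1) x) z = 0"
      using dt by (simp add: emac0 pressure0)
    moreover have "L2_inner \<Omega> (\<lambda>x. (3/2) *\<^sub>R u (k + 1) x - 2 *\<^sub>R u k x + (1/2) *\<^sub>R u (k - 1) x) z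
        = 3/2 * m (k + 1) - 2 * m k + 1/2 * m (k - 1)"
      using int_m[of "k + 1"] int_m[of k] int_m[of "k - 1"] k
      by (simp add: L2_inner_def m_def inner_add_left inner_diff_left)
    ultimately show ?thesis by simp
  qed
  have "m (-1) = m 0" unfolding m_def init(2) ..
  from two_step_recursion_const[OF step this n] have "m n = m 0" .
  moreover have "m k = L2_inner \<Omega> (u k) (\<lambda>x. B *v x + c)" if "k \<in> {-1..int N}" for k
    using replace[of "u k"] u_strip[OF that] by (simp add: m_def vanishes_on_def)
  ultimately show ?thesis using n by simp
qed

theorem theorem4p2:
  fixes \<Omega> \<Omega>s \<Omega>i :: "(real^'d::finite) set"
    and \<T> :: "(real^'d) set set"
    and Xh :: "(real^'d \<Rightarrow> real^'d) set"
    and Qh :: "(real^'d \<Rightarrow> real) set"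
    and \<N> :: "((real^'d) \<times> (real^'d)) set"
    and u0 :: "real^'d \<Rightarrow> real^'d"
    and f :: "real \<Rightarrow> real^'d \<Rightarrow> real^'d"
    and u :: "int \<Rightarrow> real^'d \<Rightarrow> real^'d"
    and P :: "int \<Rightarrow> real^'d \<Rightarrow> real"
    and \<sigma> h \<beta>0 T \<Delta>t \<nu> :: real
    and N :: nat
    and \<iota> :: "'d \<Rightarrow> 3"
  assumes dim: "CARD('d) \<in> {2, 3}"
    and \<iota>: "inj \<iota>"
    and domain: "convex_polytopal_domain \<Omega>"
    and mesh: "regular_mesh \<Omega> \<T> \<sigma> h"
    and Xh: "velocity_space \<Omega> \<T> Xh"
    and Qh: "pressure_space \<Omega> \<T> Qh"
    and inf_sup: "inf_sup_condition \<Omega> Xh Qh \<beta>0"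
    and time: "T > 0" "N > 0" "\<Delta>t = T / real N"
    and dofs: "nodal_dofs \<Omega> Xh \<N>"
    and init: "u 0 = nodal_interpolant Xh \<N> u0" "u (-1) = nodal_interpolant Xh \<N> u0"
    and \<nu>: "\<nu> = 0"
    and f: "\<And>t x. f t x = 0"
    and scheme: "emac_filtered_solution \<Omega> Xh Qh \<nu> f \<Delta>t N u P"
    and strip: "boundary_strip \<Omega> \<Omega>s" "\<Omega> = \<Omega>s \<union> \<Omega>i"
    and u_strip: "\<And>n. n \<in> {-1..int N} \<Longrightarrow> vanishes_on \<Omega>s (u n)"
    and P_strip: "\<And>n. n \<in> {1..int N} \<Longrightarrow> vanishes_on \<Omega>s (P n)"
    and \<chi>_e: "\<And>i. cutoff_available Xh \<Omega>i (\<lambda>x. axis i 1)"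
    and \<chi>_\<phi>: "\<And>i \<phi>. is_rotation_field \<iota> i \<phi> \<Longrightarrow> cutoff_available Xh \<Omega>i \<phi>"
  shows "\<forall>n\<in>{1..int N}. momentum \<Omega> (u n) = momentum \<Omega> (u 0) \<and>
           angular_momentum \<iota> \<Omega> (u n) = angular_momentum \<iota> \<Omega> (u 0)"
proof
  fix n assume "n \<in> {1..int N}"
  then have n: "n \<in> {0..int N}" by auto
  have bdd: "bounded \<Omega>" and op: "open \<Omega>"
    using domain convex_polytopal_domain_bounded[OF domain]
    by (simp_all add: convex_polytopal_domain_def)
  have \<Omega>m: "\<Omega> \<in> lmeasurable" using op bdd by (rule lmeasurable_open[rotated])
  then have \<Omega>s: "\<Omega> \<in> sets lebesgue" by auto
  have X10: "v \<in> H10_vec \<Omega>" if "v \<in> Xh" for v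
    using Xh that by (auto simp: velocity_space_def)
  \<comment> \<open>The nodal functionals attain arbitrary values on \<open>Xh\<close>, so the
    choice in the interpolant is satisfiable and lands in \<open>Xh\<close>.\<close>
  have u0X: "u 0 \<in> Xh"
  proof -
    obtain v where "v \<in> Xh" "\<forall>(p, a)\<in>\<N>. v p \<bullet> a = (\<lambda>(p, a). u0 p \<bullet> a) (p, a)"
      using dofs unfolding nodal_dofs_def by blast
    then have "\<exists>v. v \<in> Xh \<and> (\<forall>(p, a)\<in>\<N>. v p \<bullet> a = u0 p \<bullet> a)" by auto
    from someI_ex[OF this] show ?thesis by (simp add: init(1) nodal_interpolant_def)
  qed
  have uX: "u k \<in> Xh" if "k \<in> {0..int N}" for k
  proof (cases "k = 0")
    case False
    with that have "k - 1 \<in> {0..int N - 1}" by auto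
    from bspec[OF scheme[unfolded emac_filtered_solution_def] this]
    have "u (k - 1 + 1) \<in> Xh" by (elim conjE)
    then show ?thesis by simp
  qed (simp add: u0X)
  have conserved: "L2_inner \<Omega> (u n) (\<lambda>x. B *v x + c) = L2_inner \<Omega> (u 0) (\<lambda>x. B *v x + c)"
    if "transpose B = - B" "cutoff_available Xh \<Omega>i (\<lambda>x. B *v x + c)" for B :: "real^'d^'d" and c
  proof -
    have dt: "\<Delta>t \<noteq> 0" using time by simp
    have u1: "u (-1) = u 0" by (simp add: init)
    have scheme0: "emac_filtered_solution \<Omega> Xh Qh 0 f \<Delta>t N u P" using scheme by (simp add: \<nu>)
    show ?thesis
      by (rule emac_scheme_conserves_skew_affine[where f = f, OF domain mesh Xh Qh dt u0X u1 f scheme0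
            strip(2) u_strip P_strip that n])
  qed
  have "momentum \<Omega> (u n) = momentum \<Omega> (u 0)"
  proof -
    have "momentum \<Omega> (u k) $ i = L2_inner \<Omega> (u k) (\<lambda>x. axis i 1)" if k: "k \<in> {0..int N}" for k i
    proof -
      \<comment> \<open>Taking a component commutes with the vector valued integral only for
        integrable functions, so integrability is assembled from the components.\<close>
      have "integrable (lebesgue_on \<Omega>) (\<lambda>x. \<Sum>j\<in>UNIV. u k x $ j *\<^sub>R axis j (1::real))"
        by (intro Bochner_Integration.integrable_sum integrable_scaleR_left
            L2_integrable[OF \<Omega>m H10_vec_L2[OF X10[OF uX[OF k]]]])
      then have "integrable (lebesgue_on \<Omega>) (u k)"
        by (simp add: basis_expansion scalar_mult_eq_scaleR[symmetric])
      then show ?thesis by (simp add: momentum_def L2_inner_def cart_eq_inner_axis)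
    qed
    moreover have "L2_inner \<Omega> (u n) (\<lambda>x. axis i 1) = L2_inner \<Omega> (u 0) (\<lambda>x. axis i 1)" for i
      using conserved[of 0 "axis i 1"] \<chi>_e[of i] by (simp add: transpose_def vec_eq_iff)
    ultimately show ?thesis using n time(2) by (simp add: vec_eq_iff)
  qed
  moreover have "angular_momentum \<iota> \<Omega> (u n) = angular_momentum \<iota> \<Omega> (u 0)"
  proof -
    define B :: "3 \<Rightarrow> real^'d^'d" where
      "B i = (\<chi> a b. cross3 (axis (\<iota> a) 1) (axis (\<iota> b) 1) $ i)" for i
    have skew: "transpose (B i) = - B i" for i
      by (simp add: B_def transpose_def vec_eq_iff) (metis cross_skew vector_uminus_component)
    have cross: "cross3 (embed3 \<iota> v) (embed3 \<iota> x) $ i = v \<bullet> (B i *v x)" for v x i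
      unfolding B_def by (rule cross3_embed3_nth)
    have "angular_momentum \<iota> \<Omega> (u k) $ i = L2_inner \<Omega> (u k) (\<lambda>x. B i *v x)"
      if k: "k \<in> {0..int N}" for k i
    proof -
      have BL2: "(\<lambda>x. (B i *v x) $ j) \<in> L2 \<Omega>" for i j
      proof -
        have L: "bounded_linear (\<lambda>x. (B i *v x) $ j)"
          by (rule bounded_linear_compose[OF bounded_linear_vec_nth matrix_vector_mul_bounded_linear])
        obtain M where "\<forall>x\<in>\<Omega>. \<bar>(B i *v x) $ j\<bar> \<le> M"
          using affine_measurable_bounded(2)[OF bdd \<Omega>s L, of 0] by auto
        then show ?thesis
          using affine_measurable_bounded(1)[OF bdd \<Omega>s L, of 0] by (intro L2_bounded[OF \<Omega>m, of _ M]) auto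
      qed
      have "integrable (lebesgue_on \<Omega>)
          (\<lambda>x. \<Sum>j\<in>UNIV. cross3 (embed3 \<iota> (u k x)) (embed3 \<iota> x) $ j *\<^sub>R axis j (1::real))"
        unfolding cross
        by (intro Bochner_Integration.integrable_sum integrable_scaleR_left
            H10_vec_inner_integrable[OF X10[OF uX[OF k]] BL2])
      then have "integrable (lebesgue_on \<Omega>) (\<lambda>x. cross3 (embed3 \<iota> (u k x)) (embed3 \<iota> x))"
        by (simp add: basis_expansion scalar_mult_eq_scaleR[symmetric])
      then have "angular_momentum \<iota> \<Omega> (u k) $ i
          = (LINT x|lebesgue_on \<Omega>. cross3 (embed3 \<iota> (u k x)) (embed3 \<iota> x) $ i)"
        by (simp add: angular_momentum_def cart_eq_inner_axis)
      then show ?thesis by (simp add: cross L2_inner_def)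
    qed
    moreover have "L2_inner \<Omega> (u n) (\<lambda>x. B i *v x) = L2_inner \<Omega> (u 0) (\<lambda>x. B i *v x)" for i
      using rotation_matrix_cases[OF \<iota>, of i]
    proof
      \<comment> \<open>Here this component of the angular momentum is identically zero, and no
        cutoff has to exist.\<close>
      assume "(\<chi> a b. cross3 (axis (\<iota> a) 1) (axis (\<iota> b) 1) $ i) = (0 :: real^'d^'d)"
      then show ?thesis by (simp add: B_def L2_inner_def)
    next
      assume "is_rotation_field \<iota> i (\<lambda>x. (\<chi> a b. cross3 (axis (\<iota> a) 1) (axis (\<iota> b) 1) $ i) *v x)"
      then have "cutoff_available Xh \<Omega>i (\<lambda>x. B i *v x)" unfolding B_def by (rule \<chi>_\<phi>)
      then show ?thesis using conserved[OF skew, of i 0] by simp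
    qed
    ultimately show ?thesis using n time(2) by (simp add: vec_eq_iff)
  qed
  ultimately show "momentum \<Omega> (u n) = momentum \<Omega> (u 0) \<and>
      angular_momentum \<iota> \<Omega> (u n) = angular_momentum \<iota> \<Omega> (u 0)" ..
qed

end
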